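(* Let $M\in\mathbb{C}^{n\times n}$ be a positive-definite Hermitian matrix with eigenvalues $\lambda_{\max}(M)=\lambda_1(M)\ge\lambda_2(M)\ge\cdots\ge\lambda_n(M)$ and let $\bm{b}\in\mathbb{C}^n$ be a nonzero vector. Let $k\ge1$ be such that $Q_k$ and $H_k$ of the Arnoldi process for $M$ and $\bm{b}$ are defined. Then $$\|M^{1/2}\bm{b}-\operatorname{Arn}_k(x^{1/2};M,\bm{b})\|\le\frac{1}{2\sqrt{\pi}}\,\frac{2k}{2k-1}\,\bigl(\bar\lambda_{k+1}(M)\bigr)^{3/2}\,k^{-3/2}\,\|\bm{\xi}_0^k\|,$$ where $$\bar\lambda_{k+1}(M):=\frac{1}{k+1}\left(\sum_{i=1}^k\lambda_i(M)+\lambda_1(M)\right)\le\lambda_{\max}(M).$$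
   Context: $\|\cdot\|$ is the Euclidean norm. $M^{1/2}$ denotes the unique positive-definite square root of $M$; $H_k=Q_k^*MQ_k$ below is also Hermitian positive-definite and $H_k^{1/2}$ is defined in the same way. Arnoldi process: given $M$ and $\bm{b}\neq \bm 0$, set $\bm{q}_1=\bm{b}/\|\bm{b}\|$. For $j=1,2,\dots,k$: start with $\bm{w}=M\bm{q}_j$; for $i=1,\dots,j$ successively put $h_{i,j}=\bm{q}_i^*\bm{w}$ and replace $\bm{w}$ by $\bm{w}-h_{i,j}\bm{q}_i$; then put $h_{j+1,j}=\|\bm{w}\|$, stop if $h_{j+1,j}=0$, and otherwise put $\bm{q}_{j+1}=\bm{w}/h_{j+1,j}$. It is understood that the process does not stop before step $k$ (i.e. $h_{j+1,j}\ne0$ for $1\le j<k$; in particular $k\le n$). Then $Q_k=[\bm{q}_1,\dots,\bm{q}_k]$ has orthonormal columns, $H_k=[h_{i,j}]_{i,j=1}^k$ (with $h_{i,j}=0$ for $i>j+1$), and $H_k=Q_k^*MQ_k$. $\operatorname{Arn}_k(x^{1/2};M,\bm{b}):=Q_kH_k^{1/2}Q_k^*\bm{b}=\|\bm{b}\|Q_kH_k^{1/2}\bm{e}_1$, with $\bm{e}_1$ the first canonical basis vector of $\mathbb{C}^k$. $\bm{\xi}_0^k:=M^{-1}\bm{b}-Q_kH_k^{-1}\|\bm{b}\|\bm{e}_1$ is the error of the $k$-th iterate of the Full Orthogonalization Method (zero initial guess) for $M\bm{x}=\bm{b}$. *)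

theory Defs
  imports
    "HOL-Analysis.L2_Norm"
    "Jordan_Normal_Form.Schur_Decomposition"
    "Jordan_Normal_Form.Gauss_Jordan_Elimination"
begin

definition vec_norm :: "complex vec \<Rightarrow> real" where
  "vec_norm v = L2_set (\<lambda>i. cmod (v $ i)) {..<dim_vec v}"

text \<open>Since \<open>v \<bullet>c w = v \<bullet> conjugate w\<close>, the complex number \<open>x\<^sup>* A x\<close> is \<open>(A *\<^sub>v x) \<bullet>c x\<close>.
  It is real for Hermitian \<open>A\<close>.\<close>

definition hermitian_pos_def :: "nat \<Rightarrow> complex mat \<Rightarrow> bool" where
  "hermitian_pos_def n A \<longleftrightarrow>
     A \<in> carrier_mat n n \<and> mat_adjoint A = A \<and>
     (\<forall>x \<in> carrier_vec n. x \<noteq> 0\<^sub>v n \<longrightarrow> 0 < Re ((A *\<^sub>v x) \<bullet>c x))"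

definition mat_sqrt :: "complex mat \<Rightarrow> complex mat" where
  "mat_sqrt A = (THE S. hermitian_pos_def (dim_row A) S \<and> S * S = A)"

definition mat_inv :: "complex mat \<Rightarrow> complex mat" where
  "mat_inv A = the (mat_inverse A)"

definition lambda_max :: "complex mat \<Rightarrow> real" where
  "lambda_max A = Max {x. eigenvalue A (complex_of_real x)}"

text \<open>\<open>lam 1 \<ge> \<dots> \<ge> lam n\<close> are the eigenvalues of the \<open>n \<times> n\<close> matrix \<open>A\<close>, repeated according to
  multiplicity. The values of \<open>lam\<close> outside \<open>{1..n}\<close> are irrelevant.\<close>

definition ordered_eigenvalues :: "nat \<Rightarrow> complex mat \<Rightarrow> (nat \<Rightarrow> real) \<Rightarrow> bool" where
  "ordered_eigenvalues n A lam \<longleftrightarrow>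
     char_poly A = (\<Prod>i = 1..n. [:- complex_of_real (lam i), 1:]) \<and>
     antimono_on {1..n} lam"

definition lambda_bar :: "(nat \<Rightarrow> real) \<Rightarrow> nat \<Rightarrow> real" where
  "lambda_bar lam k = 1 / (real k + 1) * ((\<Sum>i = 1..k. lam i) + lam 1)"

text \<open>The inner loop of the Arnoldi process: it orthogonalises \<open>w\<close> successively against the
  vectors of the list, returning the coefficients \<open>q\<^sub>i\<^sup>* w\<close> (taken with the current \<open>w\<close>) and the
  final \<open>w\<close>.\<close>

fun orthogonalise :: "complex vec list \<Rightarrow> complex vec \<Rightarrow> complex list \<times> complex vec" where
  "orthogonalise [] w = ([], w)"
| "orthogonalise (q # qs) w =
     (let h = w \<bullet>c q; (hs, w') = orthogonalise qs (w - h \<cdot>\<^sub>v q) in (h # hs, w'))"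

definition normalise :: "complex vec \<Rightarrow> complex vec" where
  "normalise v = complex_of_real (1 / vec_norm v) \<cdot>\<^sub>v v"

text \<open>\<open>arnoldi_basis M b k\<close> is the list \<open>[q\<^sub>1, \<dots>, q\<^sub>k]\<close>. The stopping test is not built into the
  recursion but expressed by \<open>arnoldi_reaches\<close> below; the entries computed after a vanishing
  \<open>h\<^sub>j\<^sub>+\<^sub>1\<^sub>,\<^sub>j\<close> are meaningless.\<close>

fun arnoldi_basis :: "complex mat \<Rightarrow> complex vec \<Rightarrow> nat \<Rightarrow> complex vec list" where
  "arnoldi_basis M b 0 = []"
| "arnoldi_basis M b (Suc 0) = [normalise b]"
| "arnoldi_basis M b (Suc (Suc j)) =
     (let qs = arnoldi_basis M b (Suc j); (hs, w) = orthogonalise qs (M *\<^sub>v last qs)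
      in qs @ [normalise w])"

text \<open>The entry \<open>h\<^sub>i\<^sub>,\<^sub>j\<close>, with indices starting from 1 (whereas lists, vectors and matrices are
  indexed from 0).\<close>

definition arnoldi_h :: "complex mat \<Rightarrow> complex vec \<Rightarrow> nat \<Rightarrow> nat \<Rightarrow> complex" where
  "arnoldi_h M b i j =
     (let qs = arnoldi_basis M b j; (hs, w) = orthogonalise qs (M *\<^sub>v last qs)
      in if i \<le> j then hs ! (i - 1)
         else if i = j + 1 then complex_of_real (vec_norm w)
         else 0)"

text \<open>The process does not stop before step \<open>k\<close>. A stop in step \<open>k\<close> itself, \<open>h\<^sub>k\<^sub>+\<^sub>1\<^sub>,\<^sub>k = 0\<close>, is
  allowed.\<close>

definition arnoldi_reaches :: "complex mat \<Rightarrow> complex vec \<Rightarrow> nat \<Rightarrow> bool" where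
  "arnoldi_reaches M b k \<longleftrightarrow> (\<forall>j. 1 \<le> j \<and> j < k \<longrightarrow> arnoldi_h M b (j + 1) j \<noteq> 0)"

definition arnoldi_Q :: "complex mat \<Rightarrow> complex vec \<Rightarrow> nat \<Rightarrow> complex mat" where
  "arnoldi_Q M b k = mat_of_cols (dim_vec b) (arnoldi_basis M b k)"

definition arnoldi_H :: "complex mat \<Rightarrow> complex vec \<Rightarrow> nat \<Rightarrow> complex mat" where
  "arnoldi_H M b k = mat k k (\<lambda>(i, j). arnoldi_h M b (i + 1) (j + 1))"

definition arnoldi_sqrt :: "nat \<Rightarrow> complex mat \<Rightarrow> complex vec \<Rightarrow> complex vec" where
  "arnoldi_sqrt k M b =
     arnoldi_Q M b k *\<^sub>v (mat_sqrt (arnoldi_H M b k) *\<^sub>v (mat_adjoint (arnoldi_Q M b k) *\<^sub>v b))"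

definition fom_error :: "nat \<Rightarrow> complex mat \<Rightarrow> complex vec \<Rightarrow> complex vec" where
  "fom_error k M b =
     mat_inv M *\<^sub>v b -
     arnoldi_Q M b k *\<^sub>v
       (mat_inv (arnoldi_H M b k) *\<^sub>v (complex_of_real (vec_norm b) \<cdot>\<^sub>v unit_vec k 0))"

end

(* With the diagonalisations M = U diag(mu) U* and H = V diag(theta) V*, put G = U* Q V and
   d_l = ||b|| cnj(V_1l). For t >= 0 the shifted FOM error (M + t)^-1 b - Q (H + t)^-1 ||b|| e_1 has
   coordinates E_i(t) = (U* b)_i / (mu_i + t) - sum_l G_il d_l / (theta_l + t). Its residual is a multiple
   of the last Arnoldi vector, and the multiple depends on t only through 1 / det(H + t), so
     E_i(t) = E_i(0) * mu_i / (mu_i + t) * prod_l theta_l / (theta_l + t).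
   The i-th coordinate of M^(1/2) b - Arn_k is -2/pi times the integral of s^2 E_i(s^2) over s > 0.
   By convexity of x |-> log(1 + t/x) the product is at most (1 + t/L)^-(k+1) with L = lambda_bar as soon
   as sum_l theta_l + lambda_1 <= (k+1) L, which is the trace inequality of Ky Fan for H = Q* M Q. The
   integral of s^2 / (1 + s^2/L)^(k+1) is a Wallis ratio, estimated by log-convexity of Gamma.

   No improper integral is needed: the integrand has an elementary primitive, a combination of
   arctangents, which is compared with a primitive of the bound on [0, R] before letting R tend to
   infinity. *)

theory Submission
  imports "HOL-Analysis.Gamma_Function" Defs
begin

unbundle no vec_syntax

subsection \<open>Scalar estimates\<close>

text \<open>The square root enters through sqrt a = 2/pi times the integral of a / (a + s^2) over s
  > 0. Writing a / (a + s^2) = 1 - s^2 / (a + s^2), the constant parts of the mu_i term and of the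
  theta_l terms cancel, because b lies in the range of Q and hence (U^* b)_i = sum_l G_il d_l; what
  remains is -s^2 E_i(s^2). The factor mu_i / (mu_i + t) is enlarged to lambda_1 / (lambda_1 + t):
  this costs the second copy of lambda_1 in lambda_bar, but the constant no longer depends on i, so
  a bound for each coordinate is already a bound for the norms. Constants: write W_k for
  \<open>wallis_ratio k\<close>. The integral of s^2 / (1 + s^2/L)^(k+1) is L^(3/2) * pi/2 * W_(k-1)
  / (2k), and 2/pi removes pi/2. Since W_(k-1) = W_k * 2k/(2k-1) and W_k <= 1 / sqrt(pi k), the rest
  is at most 2k/(2k-1) * 1 / (2k sqrt(pi k)), which is the constant 1/(2 sqrt pi) * 2k/(2k-1) *
  k^(-3/2) of the theorem. The process only delivers a Hessenberg H; it is Hermitian because it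
  equals Q^* M Q.\<close>

definition wallis_ratio :: "nat \<Rightarrow> real" where
  "wallis_ratio k = (\<Prod>j = 1..k. (2 * real j - 1) / (2 * real j))"

lemma wallis_ratio_Suc:
  "wallis_ratio (Suc k) = wallis_ratio k * ((2 * real k + 1) / (2 * real k + 2))"
  by (simp add: wallis_ratio_def algebra_simps)

text \<open>\<open>wallis_ratio k\<close> is binom(2k,k) / 4^k. Expressing it by Gamma at a
  half-integer makes it accessible to log-convexity, which needs values between the
  integers.\<close>

lemma wallis_ratio_Gamma: "Gamma (real k + 1/2) = sqrt pi * fact k * wallis_ratio k"
proof (induction k)
  case 0
  show ?case by (simp add: Gamma_one_half_real wallis_ratio_def)
next
  case (Suc k)
  have "Gamma (real (Suc k) + 1/2) = Gamma ((real k + 1/2) + 1)"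
    by (simp add: algebra_simps)
  also have "\<dots> = (real k + 1/2) * Gamma (real k + 1/2)"
    by (rule Gamma_plus1) (auto elim!: nonpos_Ints_cases)
  also have "\<dots> = sqrt pi * fact (Suc k) * wallis_ratio (Suc k)"
    unfolding Suc wallis_ratio_Suc by (simp add: field_simps)
  finally show ?case .
qed

text \<open>The point k + 1/2 is the midpoint of k and k + 1, so log-convexity gives Gamma(k +
  1/2)^2 <= Gamma(k) Gamma(k + 1) = (k!)^2 / k. Dividing by pi (k!)^2 leaves the square of the
  claim.\<close>

lemma wallis_ratio_le:
  assumes "k \<ge> 1"
  shows "wallis_ratio k \<le> 1 / sqrt (pi * real k)"
proof -
  have k: "real k > 0" using assms by simp
  have pos: "Gamma (real k) > 0" "Gamma (real k + 1) > 0" "Gamma (real k + 1/2) > 0"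
    using k by (auto intro!: Gamma_real_pos)
  have nz: "Gamma (real k) \<noteq> 0" "Gamma (real k + 1) \<noteq> 0"
    using pos(1,2) by (metis less_irrefl)+
  have "(ln \<circ> Gamma) ((1 - 1/2) *\<^sub>R real k + (1/2) *\<^sub>R (real k + 1))
      \<le> (1 - 1/2) * (ln \<circ> Gamma) (real k) + 1/2 * (ln \<circ> Gamma) (real k + 1)"
    by (rule convex_onD[OF log_convex_Gamma_real]) (use k in auto)
  moreover have "(1 - 1/2) *\<^sub>R real k + (1/2) *\<^sub>R (real k + 1) = real k + 1/2"
    by (simp add: field_simps)
  ultimately have "2 * ln (Gamma (real k + 1/2)) \<le> ln (Gamma (real k)) + ln (Gamma (real k + 1))"
    by simp
  hence "ln ((Gamma (real k + 1/2))\<^sup>2) \<le> ln (Gamma (real k) * Gamma (real k + 1))"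
    by (simp only: ln_mult nz ln_realpow simp_thms if_True of_nat_numeral)
  hence "(Gamma (real k + 1/2))\<^sup>2 \<le> Gamma (real k) * Gamma (real k + 1)"
    by (simp only: ln_le_cancel_iff[OF zero_less_power[OF pos(3)] mult_pos_pos[OF pos(1,2)]])
  hence "real k * (Gamma (real k + 1/2))\<^sup>2 \<le> real k * Gamma (real k) * Gamma (real k + 1)"
    using k by (simp add: mult.assoc)
  also have "real k * Gamma (real k) = Gamma (real k + 1)"
    by (rule Gamma_plus1[symmetric]) (use k in \<open>auto elim!: nonpos_Ints_cases\<close>)
  also have "Gamma (real k + 1) = fact k"
    using Gamma_fact[of k, where ?'a = real] by (simp add: add.commute)
  finally have "real k * (sqrt pi * fact k * wallis_ratio k)\<^sup>2 \<le> fact k * fact k"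
    unfolding wallis_ratio_Gamma .
  hence "(fact k * fact k) * ((pi * real k) * (wallis_ratio k)\<^sup>2) \<le> (fact k * fact k) * (1::real)"
    using real_sqrt_mult_self[of pi] by (simp add: power_mult_distrib mult_ac power2_eq_square[of "fact k"])
  hence "(pi * real k) * (wallis_ratio k)\<^sup>2 \<le> 1"
    by (subst (asm) mult_le_cancel_left_pos) auto
  hence "(wallis_ratio k)\<^sup>2 \<le> (1 / sqrt (pi * real k))\<^sup>2"
    using k by (simp add: field_simps)
  thus ?thesis
    by (rule power2_le_imp_le) (use k in auto)
qed

section \<open>Rational integrands: elementary primitives and their limits at infinity\<close>

primrec rational_arctan :: "nat \<Rightarrow> real \<Rightarrow> real" where
  "rational_arctan 0 s = arctan s"
| "rational_arctan (Suc m) s =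
     ((2 * real m + 1) * rational_arctan m s + s / (1 + s\<^sup>2) ^ (m + 1)) / (2 * real m + 2)"

lemma one_plus_square_pos: "1 + (s::real)\<^sup>2 > 0"
  by (smt (verit) zero_le_power2)

text \<open>The derivative is split into the two integrands that occur. Rewriting s^2 as (1 + s^2) -
  1 turns it into the reduction formula behind \<open>rational_arctan\<close>; solving it for the
  s^2 term gives the primitive needed for the bound.\<close>

lemma deriv_ratio:
  "((\<lambda>s::real. s / (1 + s\<^sup>2) ^ (m + 1)) has_field_derivative
     (1 / (1 + s\<^sup>2) ^ (m + 1) - (2 * real m + 2) * s\<^sup>2 / (1 + s\<^sup>2) ^ (m + 2))) (at s)"
proof -
  have q: "1 + s\<^sup>2 \<noteq> 0" using one_plus_square_pos[of s] by auto
  have "((\<lambda>s::real. (1 + s\<^sup>2) ^ (m + 1)) has_field_derivative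
      real (m + 1) * (2 * s * (1 + s\<^sup>2) ^ m)) (at s)"
    by (rule DERIV_cong, rule DERIV_power) (auto intro!: derivative_eq_intros)
  from DERIV_divide[OF DERIV_ident this]
  have "((\<lambda>s::real. s / (1 + s\<^sup>2) ^ (m + 1)) has_field_derivative
      (1 * (1 + s\<^sup>2) ^ (m + 1) - s * (real (m + 1) * (2 * s * (1 + s\<^sup>2) ^ m))) /
      ((1 + s\<^sup>2) ^ (m + 1) * (1 + s\<^sup>2) ^ (m + 1))) (at s)"
    using q by simp
  moreover have "(1 * (q * p) - s * (real (m + 1) * (2 * s * p))) / ((q * p) * (q * p))
      = 1 / (q * p) - (2 * real m + 2) * s\<^sup>2 / (q * (q * p))" if "p \<noteq> 0" "q \<noteq> 0" for p q
    using that by (simp add: field_simps power2_eq_square)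
  from this[of "(1 + s\<^sup>2) ^ m", OF _ q] q
  have "(1 * (1 + s\<^sup>2) ^ (m + 1) - s * (real (m + 1) * (2 * s * (1 + s\<^sup>2) ^ m))) /
      ((1 + s\<^sup>2) ^ (m + 1) * (1 + s\<^sup>2) ^ (m + 1))
      = 1 / (1 + s\<^sup>2) ^ (m + 1) - (2 * real m + 2) * s\<^sup>2 / (1 + s\<^sup>2) ^ (m + 2)"
    by (simp only: add_2_eq_Suc' Suc_eq_plus1[symmetric] power_Suc) simp
  ultimately show ?thesis by simp
qed

text \<open>The recursion of \<open>rational_arctan\<close> is the reduction formula obtained by
  partial integration; the primitive it builds is the one vanishing at 0.\<close>

lemma has_derivative_rational_arctan:
  "(rational_arctan m has_field_derivative 1 / (1 + s\<^sup>2) ^ (m + 1)) (at s)"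
proof (induction m)
  case 0
  show ?case
    by (auto intro!: derivative_eq_intros simp: divide_simps)
next
  case (Suc m)
  have nz: "1 + s\<^sup>2 \<noteq> 0" using one_plus_square_pos[of s] by auto
  have "(rational_arctan (Suc m) has_field_derivative
     ((2 * real m + 1) * (1 / (1 + s\<^sup>2) ^ (m + 1)) +
      (1 / (1 + s\<^sup>2) ^ (m + 1) - (2 * real m + 2) * s\<^sup>2 / (1 + s\<^sup>2) ^ (m + 2))) / (2 * real m + 2)) (at s)"
    unfolding rational_arctan.simps[abs_def]
    by (intro DERIV_cdivide DERIV_add DERIV_cmult Suc deriv_ratio)
  moreover have "((2 * real m + 1) * (1 / (1 + s\<^sup>2) ^ (m + 1)) +
      (1 / (1 + s\<^sup>2) ^ (m + 1) - (2 * real m + 2) * s\<^sup>2 / (1 + s\<^sup>2) ^ (m + 2))) / (2 * real m + 2)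
      = 1 / (1 + s\<^sup>2) ^ (Suc m + 1)"
  proof -
    have "((2 * real m + 1) * (1 / p) + (1 / p - (2 * real m + 2) * (q - 1) / (q * p)))
        / (2 * real m + 2) = 1 / (q * p)" if "p \<noteq> 0" "q \<noteq> 0" for p q :: real
      using that by (simp add: divide_simps) (simp add: algebra_simps)
    from this[of "(1 + s\<^sup>2) ^ (m + 1)" "1 + s\<^sup>2"] nz
    show ?thesis by (simp only: add_2_eq_Suc' Suc_eq_plus1[symmetric] power_Suc) simp
  qed
  ultimately show ?case by (simp only:)
qed

lemma ratio_tendsto_0: "((\<lambda>s::real. s / (1 + s\<^sup>2) ^ (m + 1)) \<longlongrightarrow> 0) at_top"
proof (rule tendsto_sandwich[where f = "\<lambda>_. 0" and h = "\<lambda>s. 1 / s"])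
  show "\<forall>\<^sub>F s::real in at_top. 0 \<le> s / (1 + s\<^sup>2) ^ (m + 1)"
    using eventually_ge_at_top[of 0] by eventually_elim (simp add: add_nonneg_nonneg)
  show "\<forall>\<^sub>F s::real in at_top. s / (1 + s\<^sup>2) ^ (m + 1) \<le> 1 / s"
    using eventually_gt_at_top[of 0]
  proof eventually_elim
    case (elim s)
    have "1 + s\<^sup>2 \<le> (1 + s\<^sup>2) ^ (m + 1)"
      by (rule self_le_power) auto
    hence "s * s \<le> (1 + s\<^sup>2) ^ (m + 1)" by (simp add: power2_eq_square)
    moreover have "(1 + s\<^sup>2) ^ (m + 1) > 0" using one_plus_square_pos[of s] by simp
    ultimately show ?case using elim by (simp add: divide_simps del: power_Suc)
  qed
  show "((\<lambda>s::real. 1 / s) \<longlongrightarrow> 0) at_top"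
    using tendsto_inverse_0_at_top[OF filterlim_ident] by (simp add: inverse_eq_divide)
qed simp

text \<open>The boundary term vanishes at infinity, so each recursion step multiplies the limit,
  which starts as the pi/2 of arctan, by (2m + 1) / (2m + 2), the new factor of
  \<open>wallis_ratio\<close>.\<close>

lemma rational_arctan_tendsto: "(rational_arctan m \<longlongrightarrow> pi / 2 * wallis_ratio m) at_top"
proof (induction m)
  case 0
  show ?case using tendsto_arctan_at_top by (simp add: wallis_ratio_def)
next
  case (Suc m)
  have "(rational_arctan (Suc m) \<longlongrightarrow>
     ((2 * real m + 1) * (pi / 2 * wallis_ratio m) + 0) / (2 * real m + 2)) at_top"
    unfolding rational_arctan.simps[abs_def]
    by (intro tendsto_intros Suc ratio_tendsto_0) auto
  moreover have "((2 * real m + 1) * (pi / 2 * wallis_ratio m) + 0) / (2 * real m + 2)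
      = pi / 2 * wallis_ratio (Suc m)"
    by (simp add: wallis_ratio_Suc)
  ultimately show ?case by (simp only:)
qed

text \<open>This stands in for estimating an integral over the half-line: the right-hand side is
  \<open>c\<close> times the integral of s^2 / (1 + s^2/L)^(k+1), and the mean value inequality on
  [0, R] compares \<open>F\<close> with a primitive \<open>\<phi>\<close> of the bound.\<close>

lemma norm_limit_le_of_derivative_bound:
  fixes F F' :: "real \<Rightarrow> complex"
  assumes L: "L > 0" and c: "c \<ge> 0" and k: "k \<ge> 1"
    and F0: "F 0 = 0"
    and F': "\<And>s. (F has_vector_derivative F' s) (at s)"
    and bnd: "\<And>s. s > 0 \<Longrightarrow> norm (F' s) \<le> c * (s\<^sup>2 / (1 + s\<^sup>2 / L) ^ (k + 1))"
    and lim: "(F \<longlongrightarrow> l) at_top"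
  shows "norm l \<le> c * (L powr (3/2) * (pi / 2 * wallis_ratio (k - 1) / (2 * real k)))"
proof -
  obtain m where m: "k = m + 1" using k by (metis add.commute le_Suc_ex)
  define r where "r = sqrt L"
  have r: "r > 0" "r\<^sup>2 = L" using L by (auto simp: r_def)
  have r3: "L powr (3/2) = r ^ 3"
    using L by (simp add: r_def powr_half_sqrt[symmetric] powr_powr powr_numeral[symmetric] del: powr_numeral)
  \<comment> \<open>With k + 1 = m + 2, this is the primitive of s^2 / (1 + s^2)^(m+2): the s^2 term
    of \<open>deriv_ratio\<close> is isolated against \<open>rational_arctan m\<close>.\<close>
  define B where "B = (\<lambda>s. (rational_arctan m s - s / (1 + s\<^sup>2) ^ (m + 1)) / (2 * real m + 2))"
  \<comment> \<open>Substitution s = r u with r = sqrt L: s^2 contributes r^2 and ds contributes r,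
    whence L^(3/2).\<close>
  define \<phi> where "\<phi> = (\<lambda>s. c * r ^ 3 * B (s / r))"
  have B': "(B has_field_derivative s\<^sup>2 / (1 + s\<^sup>2) ^ (m + 2)) (at s)" for s
  proof -
    have "(B has_field_derivative (1 / (1 + s\<^sup>2) ^ (m + 1) -
        (1 / (1 + s\<^sup>2) ^ (m + 1) - (2 * real m + 2) * s\<^sup>2 / (1 + s\<^sup>2) ^ (m + 2))) / (2 * real m + 2)) (at s)"
      unfolding B_def
      by (intro DERIV_cdivide DERIV_diff has_derivative_rational_arctan deriv_ratio)
    moreover have "2 * real m + 2 \<noteq> 0" by linarith
    ultimately show ?thesis by (simp del: power_Suc)
  qed
  have \<phi>': "(\<phi> has_field_derivative c * (s\<^sup>2 / (1 + s\<^sup>2 / L) ^ (k + 1))) (at s)" for s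
  proof -
    have "((\<lambda>s. B (s / r)) has_field_derivative (s / r)\<^sup>2 / (1 + (s / r)\<^sup>2) ^ (m + 2) * (1 / r)) (at s)"
      by (rule DERIV_chain2[OF B' DERIV_cdivide[OF DERIV_ident]])
    from DERIV_cmult[OF this, of "c * r ^ 3"]
    have "(\<phi> has_field_derivative c * r ^ 3 * ((s / r)\<^sup>2 / (1 + (s / r)\<^sup>2) ^ (m + 2) * (1 / r))) (at s)"
      unfolding \<phi>_def .
    moreover have "c * r ^ 3 * ((s / r)\<^sup>2 / (1 + (s / r)\<^sup>2) ^ (m + 2) * (1 / r))
        = c * (r ^ 3 * ((s / r)\<^sup>2 * (1 / r)) / (1 + (s / r)\<^sup>2) ^ (m + 2))"
      by (simp add: mult_ac del: power_Suc)
    moreover have "r ^ 3 * ((s / r)\<^sup>2 * (1 / r)) = s\<^sup>2"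
      using r(1) by (simp add: power_divide power3_eq_cube power2_eq_square)
    moreover have "(s / r)\<^sup>2 = s\<^sup>2 / L" by (simp add: power_divide r)
    ultimately have "(\<phi> has_field_derivative c * (s\<^sup>2 / (1 + s\<^sup>2 / L) ^ (m + 2))) (at s)"
      by (simp only:)
    thus ?thesis by (simp add: m)
  qed
  have \<phi>0: "\<phi> 0 = 0"
  proof -
    have "rational_arctan m 0 = 0" by (induction m) auto
    thus ?thesis by (simp add: \<phi>_def B_def)
  qed
  have le: "norm (F R) \<le> \<phi> R" if "R > 0" for R
  proof -
    have "norm (F R - F 0) \<le> \<phi> R - \<phi> 0"
    proof (rule differentiable_bound_general[OF that])
      show "continuous_on {0..R} F"
        using F' by (intro continuous_at_imp_continuous_on ballI) (rule has_vector_derivative_continuous)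
      show "continuous_on {0..R} \<phi>"
        using \<phi>' by (intro continuous_at_imp_continuous_on ballI DERIV_isCont)
      show "(F has_vector_derivative F' x) (at x)" for x by (rule F')
      show "(\<phi> has_vector_derivative c * (x\<^sup>2 / (1 + x\<^sup>2 / L) ^ (k + 1))) (at x)" for x
        using \<phi>' by (simp add: has_real_derivative_iff_has_vector_derivative)
      show "norm (F' x) \<le> c * (x\<^sup>2 / (1 + x\<^sup>2 / L) ^ (k + 1))" if "0 < x" for x
        by (rule bnd[OF that])
    qed
    thus ?thesis by (simp add: F0 \<phi>0)
  qed
  have "filterlim (\<lambda>s. s / r) at_top at_top"
    using r(1) by (simp add: filterlim_tendsto_pos_mult_at_top divide_inverse
        filterlim_at_top_mult_tendsto_pos[OF tendsto_const _ filterlim_ident])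
  moreover have "(B \<longlongrightarrow> (pi / 2 * wallis_ratio m - 0) / (2 * real m + 2)) at_top"
    unfolding B_def by (intro tendsto_intros rational_arctan_tendsto ratio_tendsto_0) auto
  ultimately have "((\<lambda>s. B (s / r)) \<longlongrightarrow> (pi / 2 * wallis_ratio m - 0) / (2 * real m + 2)) at_top"
    by (rule filterlim_compose[rotated])
  hence "(\<phi> \<longlongrightarrow> c * r ^ 3 * ((pi / 2 * wallis_ratio m - 0) / (2 * real m + 2))) at_top"
    unfolding \<phi>_def by (intro tendsto_intros)
  moreover have "((\<lambda>R. norm (F R)) \<longlongrightarrow> norm l) at_top"
    using lim by (rule tendsto_norm)
  moreover have "\<forall>\<^sub>F R in at_top. norm (F R) \<le> \<phi> R"
    using eventually_gt_at_top[of 0] by eventually_elim (rule le)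
  ultimately have "norm l \<le> c * r ^ 3 * ((pi / 2 * wallis_ratio m - 0) / (2 * real m + 2))"
    by (intro tendsto_le[OF trivial_limit_at_top_linorder])
  thus ?thesis by (simp add: r3 m mult_ac add.commute)
qed


text \<open>Jensen's inequality for log(1 + t/x), proved by a tangent line so that no logarithm
  appears. The concave map x / (x + t) lies below its tangent at L, and 1 + y <= exp y turns the
  product of the tangent bounds into the exponential of a sum, which is at most 1 by
  \<open>mean\<close>. An upper bound on the mean suffices because the slope is nonnegative.\<close>

lemma prod_shift_ratio_le:
  fixes \<theta> :: "nat \<Rightarrow> real"
  assumes L: "L > 0" and t: "t \<ge> 0" and pos: "\<And>i. i < N \<Longrightarrow> \<theta> i > 0"
    and mean: "(\<Sum>i<N. \<theta> i) \<le> real N * L"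
  shows "(\<Prod>i<N. \<theta> i / (\<theta> i + t)) \<le> 1 / (1 + t / L) ^ N"
proof -
  \<comment> \<open>\<open>c\<close> is the logarithmic derivative of x / (x + t) at x = L, the
    slope of the tangent after its value at L is normalised to 1.\<close>
  define c where "c = t / (L * (L + t))"
  have c: "c \<ge> 0" using L t by (simp add: c_def)
  have q: "1 + t / L > 0" using L t by (simp add: add_pos_nonneg)
  have single: "\<theta> i / (\<theta> i + t) \<le> 1 / (1 + t / L) * exp (c * (\<theta> i - L))" if "i < N" for i
  proof -
    have p: "\<theta> i > 0" "\<theta> i + t > 0" "L + t > 0" using pos[OF that] L t by auto
    \<comment> \<open>The gap between tangent and function is an explicit nonnegative multiple of
      \<open>(\<theta> i - L)\<^sup>2\<close>.\<close>
    have "(1 + c * (\<theta> i - L)) - \<theta> i / (\<theta> i + t) * (1 + t / L)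
        = t * (\<theta> i - L)\<^sup>2 / (L * (L + t) * (\<theta> i + t))"
      using L p unfolding c_def power2_eq_square by (simp add: divide_simps) (simp add: algebra_simps)
    moreover have "\<dots> \<ge> 0" using L p t by simp
    ultimately have "\<theta> i / (\<theta> i + t) * (1 + t / L) \<le> 1 + c * (\<theta> i - L)" by linarith
    also have "\<dots> \<le> exp (c * (\<theta> i - L))" by (rule exp_ge_add_one_self)
    finally have "\<theta> i / (\<theta> i + t) \<le> exp (c * (\<theta> i - L)) / (1 + t / L)"
      by (subst pos_le_divide_eq[OF q])
    thus ?thesis by simp
  qed
  have "(\<Prod>i<N. \<theta> i / (\<theta> i + t)) \<le> (\<Prod>i<N. 1 / (1 + t / L) * exp (c * (\<theta> i - L)))"
    by (rule prod_mono) (use single pos t in \<open>simp add: less_imp_le add_pos_nonneg\<close>)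
  also have "\<dots> = (1 / (1 + t / L)) ^ N * exp (\<Sum>i<N. c * (\<theta> i - L))"
    by (simp only: prod.distrib exp_sum[OF finite_lessThan] prod_constant card_lessThan)
  also have "\<dots> \<le> (1 / (1 + t / L)) ^ N * 1"
  proof (rule mult_left_mono)
    have "(\<Sum>i<N. c * (\<theta> i - L)) = c * ((\<Sum>i<N. \<theta> i) - real N * L)"
      by (simp add: sum_distrib_left[symmetric] sum_subtractf)
    also have "\<dots> \<le> 0" using c mean by (intro mult_nonneg_nonpos) auto
    finally show "exp (\<Sum>i<N. c * (\<theta> i - L)) \<le> 1" by simp
  qed (use q in simp)
  finally show ?thesis by (simp add: power_divide)
qed

text \<open>Square roots arise from this primitive: it runs from 0 to sqrt a * pi/2 on the
  half-line.\<close>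

lemma scaled_arctan_derivative:
  assumes "a > 0"
  shows "((\<lambda>s. sqrt a * arctan (s / sqrt a)) has_field_derivative a / (a + s\<^sup>2)) (at s)"
proof -
  have r: "sqrt a > 0" using assms by simp
  have "((\<lambda>s. sqrt a * arctan (s / sqrt a)) has_field_derivative
      sqrt a * (inverse (1 + (s / sqrt a)\<^sup>2) * (1 / sqrt a))) (at s)"
    by (rule DERIV_cmult, rule DERIV_chain2[OF DERIV_arctan DERIV_cdivide[OF DERIV_ident]])
  moreover have "sqrt a * (inverse (1 + (s / sqrt a)\<^sup>2) * (1 / sqrt a)) = a / (a + s\<^sup>2)"
    using assms r add_pos_nonneg[OF assms zero_le_power2[of s]] by (simp add: power_divide divide_simps)
  ultimately show ?thesis by simp
qed

lemma scaled_arctan_tendsto: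
  assumes "a > 0"
  shows "((\<lambda>s. sqrt a * arctan (s / sqrt a)) \<longlongrightarrow> sqrt a * (pi / 2)) at_top"
proof -
  have "filterlim (\<lambda>s. s / sqrt a) at_top at_top"
    using assms by (simp add: divide_inverse filterlim_at_top_mult_tendsto_pos[OF tendsto_const _ filterlim_ident])
  thus ?thesis by (intro tendsto_intros filterlim_compose[OF tendsto_arctan_at_top])
qed

text \<open>The scalar core, for one eigen-coordinate: \<open>a\<close> is the eigenvalue of that
  coordinate and \<open>A\<close> the largest one, \<open>\<beta>\<close> the coordinate of b,
  \<open>g l\<close> its splitting over the Ritz vectors, and \<open>x\<close> the coordinate of the
  FOM error. \<open>shifted\<close> is the factorisation of the shifted error, \<open>mean\<close>
  the trace inequality.\<close>

lemma sqrt_combination_bound: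
  fixes \<beta> x :: complex and g :: "nat \<Rightarrow> complex" and \<theta> :: "nat \<Rightarrow> real"
  assumes a: "0 < a" "a \<le> A" and L: "L > 0" and k: "k \<ge> 1"
    and pos: "\<And>l. l < k \<Longrightarrow> \<theta> l > 0"
    and mean: "(\<Sum>l<k. \<theta> l) + A \<le> (real k + 1) * L"
    and \<beta>: "\<beta> = (\<Sum>l<k. g l)"
    and shifted: "\<And>t. t > 0 \<Longrightarrow> \<beta> / of_real (a + t) - (\<Sum>l<k. g l / of_real (\<theta> l + t)) =
        x * of_real (a / (a + t) * (\<Prod>l<k. \<theta> l / (\<theta> l + t)))"
  shows "norm (of_real (sqrt a) * \<beta> - (\<Sum>l<k. of_real (sqrt (\<theta> l)) * g l))
    \<le> 1 / (2 * sqrt pi) * (2 * real k / (2 * real k - 1)) * L powr (3/2) * real k powr (- 3/2) * norm x"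
proof -
  define atn where "atn = (\<lambda>a s. sqrt a * arctan (s / sqrt a))"
  define F where "F = (\<lambda>s. of_real (atn a s) * \<beta> - (\<Sum>l<k. of_real (atn (\<theta> l) s) * g l))"
  define F' where "F' = (\<lambda>s. of_real (a / (a + s\<^sup>2)) * \<beta> - (\<Sum>l<k. of_real (\<theta> l / (\<theta> l + s\<^sup>2)) * g l))"
  define D where "D = of_real (sqrt a) * \<beta> - (\<Sum>l<k. of_real (sqrt (\<theta> l)) * g l)"
  have atn': "((\<lambda>s. complex_of_real (atn a s)) has_vector_derivative of_real (a / (a + s\<^sup>2))) (at s)"
    if "a > 0" for a s
    unfolding atn_def using scaled_arctan_derivative[OF that, of s]
    by (intro has_vector_derivative_of_real) (simp add: has_real_derivative_iff_has_vector_derivative)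
  have der: "(F has_vector_derivative F' s) (at s)" for s
    unfolding F_def F'_def
    by (intro has_vector_derivative_diff has_vector_derivative_sum has_vector_derivative_mult_left atn')
       (use a pos in auto)
  \<comment> \<open>Each a / (a + s^2) equals 1 - s^2 / (a + s^2), and the ones cancel by
    \<open>\<beta>\<close>; \<open>shifted\<close> at t = s^2 then applies.\<close>
  have F'_eq: "F' s = - of_real (s\<^sup>2) * (x * of_real (a / (a + s\<^sup>2) * (\<Prod>l<k. \<theta> l / (\<theta> l + s\<^sup>2))))"
    if s: "s > 0" for s
  proof -
    have part: "of_real (c / (c + s\<^sup>2)) * z = z - of_real (s\<^sup>2) * (z / of_real (c + s\<^sup>2))"
      if "c > 0" for c and z :: complex
    proof -
      have "c + s\<^sup>2 \<noteq> 0" using that by (metis add_pos_nonneg less_irrefl zero_le_power2)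
      hence "c / (c + s\<^sup>2) = 1 - s\<^sup>2 / (c + s\<^sup>2)" by (simp add: field_simps)
      thus ?thesis by (simp add: left_diff_distrib)
    qed
    have "F' s = (\<beta> - of_real (s\<^sup>2) * (\<beta> / of_real (a + s\<^sup>2)))
       - (\<Sum>l<k. g l - of_real (s\<^sup>2) * (g l / of_real (\<theta> l + s\<^sup>2)))"
      unfolding F'_def part[OF a(1)] by (intro arg_cong2[of _ _ _ _ "(-)"] refl sum.cong part pos) auto
    also have "\<dots> = - of_real (s\<^sup>2) * (\<beta> / of_real (a + s\<^sup>2) - (\<Sum>l<k. g l / of_real (\<theta> l + s\<^sup>2)))"
      unfolding sum_subtractf \<beta>[symmetric] sum_distrib_left[symmetric] by (simp add: algebra_simps)
    finally show ?thesis using shifted[of "s\<^sup>2"] s by simp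
  qed
  have bnd: "norm (F' s) \<le> norm x * (s\<^sup>2 / (1 + s\<^sup>2 / L) ^ (k + 1))" if s: "s > 0" for s
  proof -
    define t where "t = s\<^sup>2"
    have t: "t > 0" using s by (simp add: t_def)
    \<comment> \<open>\<open>A\<close> is appended at index k, so that the product estimate runs
      over k + 1 numbers, whose sum is bounded by \<open>mean\<close>.\<close>
    define \<theta>' where "\<theta>' = (\<lambda>l. if l < k then \<theta> l else A)"
    have "(\<Prod>i<k + 1. \<theta>' i / (\<theta>' i + t)) \<le> 1 / (1 + t / L) ^ (k + 1)"
    proof (rule prod_shift_ratio_le[OF L less_imp_le[OF t]])
      show "\<theta>' i > 0" if "i < k + 1" for i using pos a by (simp add: \<theta>'_def)
      show "sum \<theta>' {..<k + 1} \<le> real (k + 1) * L" using mean by (simp add: \<theta>'_def add.commute)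
    qed
    also have "(\<Prod>i<k + 1. \<theta>' i / (\<theta>' i + t)) = (\<Prod>i<k. \<theta> i / (\<theta> i + t)) * (A / (A + t))"
      by (simp add: \<theta>'_def)
    finally have P: "(\<Prod>i<k. \<theta> i / (\<theta> i + t)) * (A / (A + t)) \<le> 1 / (1 + t / L) ^ (k + 1)" .
    have P0: "(\<Prod>i<k. \<theta> i / (\<theta> i + t)) \<ge> 0"
      using pos t by (intro prod_nonneg ballI divide_nonneg_nonneg add_nonneg_nonneg less_imp_le) auto
    \<comment> \<open>x / (x + t) increases in x; replacing \<open>a\<close> by \<open>A\<close>
      frees the bound from the coordinate.\<close>
    have "a / (a + t) \<le> A / (A + t)" using a t by (simp add: divide_simps) (simp add: algebra_simps)
    hence "a / (a + t) * (\<Prod>i<k. \<theta> i / (\<theta> i + t)) \<le> 1 / (1 + t / L) ^ (k + 1)"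
      using P mult_right_mono[OF _ P0, of "a / (a + t)" "A / (A + t)"] by (simp add: mult.commute)
    hence "norm x * t * (a / (a + t) * (\<Prod>i<k. \<theta> i / (\<theta> i + t)))
        \<le> norm x * t * (1 / (1 + t / L) ^ (k + 1))"
      by (rule mult_left_mono) (use t in simp)
    moreover have "norm (F' s) = norm x * t * (a / (a + t) * (\<Prod>i<k. \<theta> i / (\<theta> i + t)))"
      unfolding F'_eq[OF s] norm_mult norm_minus_cancel norm_of_real t_def[symmetric] abs_mult
      using P0 t a by (simp add: abs_mult)
    ultimately show ?thesis by (simp add: t_def)
  qed
  have "(F \<longlongrightarrow> of_real (sqrt a * (pi / 2)) * \<beta> - (\<Sum>l<k. of_real (sqrt (\<theta> l) * (pi / 2)) * g l)) at_top"
    unfolding F_def atn_def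
    by (intro tendsto_intros scaled_arctan_tendsto) (use a pos in auto)
  also have "of_real (sqrt a * (pi / 2)) * \<beta> - (\<Sum>l<k. of_real (sqrt (\<theta> l) * (pi / 2)) * g l) = of_real (pi / 2) * D"
    unfolding D_def right_diff_distrib sum_distrib_left by (simp add: mult_ac)
  finally have lim: "(F \<longlongrightarrow> of_real (pi / 2) * D) at_top" .
  have F0: "F 0 = 0" by (simp add: F_def atn_def)
  have "norm (of_real (pi / 2) * D)
      \<le> norm x * (L powr (3/2) * (pi / 2 * wallis_ratio (k - 1) / (2 * real k)))"
    by (rule norm_limit_le_of_derivative_bound[OF L norm_ge_zero k F0 der bnd lim])
  \<comment> \<open>The limit of \<open>F\<close> carries the factor pi/2 from arctan, which cancels
    against the pi/2 of the Wallis integral.\<close>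
  hence "pi / 2 * norm D \<le> pi / 2 * (norm x * (L powr (3/2) * (wallis_ratio (k - 1) / (2 * real k))))"
    by (simp add: norm_mult mult_ac)
  hence D: "norm D \<le> norm x * (L powr (3/2) * (wallis_ratio (k - 1) / (2 * real k)))"
    by (subst (asm) mult_le_cancel_left_pos) auto
  have "wallis_ratio (k - 1) / (2 * real k)
      \<le> 1 / (2 * sqrt pi) * (2 * real k / (2 * real k - 1)) * real k powr (- 3/2)"
  proof -
    obtain m where m: "k = Suc m" using k by (cases k) auto
    \<comment> \<open>The Gamma estimate is applied at k and not at k - 1: for k = 1 the latter
      would ask for W_0 = 1 to lie below 1 / sqrt 0, which is 0 here. The price is the factor 2k /
      (2k - 1).\<close>
    have w: "wallis_ratio (k - 1) = wallis_ratio k * (2 * real k / (2 * real k - 1))"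
    proof -
      have "(2 * real m + 1) / (2 * real m + 2) * (2 * real k / (2 * real k - 1)) = 1"
        by (simp add: m add.commute)
      hence "wallis_ratio m * ((2 * real m + 1) / (2 * real m + 2) * (2 * real k / (2 * real k - 1)))
          = wallis_ratio m" by (simp only: mult_1_right)
      thus ?thesis unfolding m wallis_ratio_Suc by (simp only: mult.assoc diff_Suc_1)
    qed
    have "wallis_ratio (k - 1) \<le> 1 / sqrt (pi * real k) * (2 * real k / (2 * real k - 1))"
      unfolding w using k by (intro mult_right_mono wallis_ratio_le) auto
    hence "wallis_ratio (k - 1) / (2 * real k)
        \<le> 1 / sqrt (pi * real k) * (2 * real k / (2 * real k - 1)) / (2 * real k)"
      by (rule divide_right_mono) simp
    also have "1 / sqrt (pi * real k) * (2 * real k / (2 * real k - 1)) / (2 * real k)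
        = 1 / sqrt (pi * real k) / (2 * real k) * (2 * real k / (2 * real k - 1))"
      by (simp only: times_divide_eq_left)
    also have "1 / sqrt (pi * real k) / (2 * real k) = 1 / (2 * sqrt pi) * real k powr (- 3/2)"
    proof -
      have "real k powr (3/2) = real k powr (1 + 1/2)" by simp
      also have "\<dots> = real k * sqrt (real k)"
        unfolding powr_add using k by (simp add: powr_half_sqrt)
      finally have "real k powr (- 3/2) = 1 / (real k * sqrt (real k))"
        using powr_minus_divide[of "real k" "3/2"] by simp
      thus ?thesis by (simp add: real_sqrt_mult)
    qed
    finally show ?thesis by (simp only: mult_ac)
  qed
  hence "norm x * (L powr (3/2) * (wallis_ratio (k - 1) / (2 * real k)))
    \<le> norm x * (L powr (3/2) * (1 / (2 * sqrt pi) * (2 * real k / (2 * real k - 1)) * real k powr (- 3/2)))"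
    by (intro mult_left_mono) auto
  with D show ?thesis unfolding D_def by (simp add: mult_ac)
qed

subsection \<open>Hermitian matrices\<close>

lemma dim_mat_adjoint [simp]:
  "dim_row (mat_adjoint A) = dim_col A" "dim_col (mat_adjoint A) = dim_row A"
  by (simp_all add: mat_adjoint_def)

lemma mat_adjoint_carrier [simp]: "A \<in> carrier_mat m n \<Longrightarrow> mat_adjoint A \<in> carrier_mat n m"
  by (auto intro: carrier_matI)

lemma mult_square_carrier [simp]:
  "A \<in> carrier_mat n n \<Longrightarrow> B \<in> carrier_mat n n \<Longrightarrow> A * B \<in> carrier_mat n n"
  by simp

lemma mat_adjoint_index [simp]:
  "i < dim_col A \<Longrightarrow> j < dim_row A \<Longrightarrow> mat_adjoint A $$ (i, j) = conjugate (A $$ (j, i))"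
  by (simp add: mat_adjoint_def mat_of_rows_index)

lemma mat_adjoint_adjoint [simp]: "mat_adjoint (mat_adjoint (A :: complex mat)) = A"
  by (rule eq_matI) auto

lemma mat_mult_index_sum:
  "i < dim_row A \<Longrightarrow> j < dim_col B \<Longrightarrow> (A * B) $$ (i, j) = (\<Sum>l<dim_row B. A $$ (i, l) * B $$ (l, j))"
  if "dim_col A = dim_row B" for A B :: "complex mat"
  using that by (simp add: scalar_prod_def atLeast0LessThan)

lemma mat_vec_index_sum:
  "i < dim_row A \<Longrightarrow> (A *\<^sub>v v) $ i = (\<Sum>l<dim_vec v. A $$ (i, l) * v $ l)"
  if "dim_col A = dim_vec v" for A :: "complex mat"
  using that by (simp add: scalar_prod_def atLeast0LessThan)

lemma cscalar_prod_sum: "v \<bullet>c w = (\<Sum>i<dim_vec w. v $ i * cnj (w $ i))" for v w :: "complex vec"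
  by (simp add: scalar_prod_def atLeast0LessThan)

lemma mat_adjoint_mult:
  fixes A B :: "complex mat"
  assumes "dim_col A = dim_row B"
  shows "mat_adjoint (A * B) = mat_adjoint B * mat_adjoint A"
proof (rule eq_matI)
  fix i j assume ij: "i < dim_row (mat_adjoint B * mat_adjoint A)" "j < dim_col (mat_adjoint B * mat_adjoint A)"
  thus "mat_adjoint (A * B) $$ (i, j) = (mat_adjoint B * mat_adjoint A) $$ (i, j)"
    using assms by (simp add: mat_mult_index_sum mult.commute del: index_mult_mat(1))
qed auto

lemma mat_adjoint_diag: "mat_adjoint (mat_diag n f :: complex mat) = mat_diag n (\<lambda>i. cnj (f i))"
  by (rule eq_matI) (auto simp: mat_diag_def)

lemma mat_adjoint_mult_index:
  fixes A B :: "complex mat"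
  assumes "dim_row A = dim_row B" "i < dim_col A" "j < dim_col B"
  shows "(mat_adjoint A * B) $$ (i, j) = col B j \<bullet>c col A i"
  using assms by (simp add: scalar_prod_def mult.commute)

lemma mult_mat_vec_cscalar:
  fixes A :: "complex mat"
  assumes "A \<in> carrier_mat m n" "x \<in> carrier_vec n" "y \<in> carrier_vec m"
  shows "(A *\<^sub>v x) \<bullet>c y = x \<bullet>c (mat_adjoint A *\<^sub>v y)"
proof -
  have "(A *\<^sub>v x) \<bullet>c y = (\<Sum>i<m. \<Sum>l<n. A $$ (i, l) * x $ l * cnj (y $ i))"
    using assms by (simp add: cscalar_prod_sum mat_vec_index_sum sum_distrib_right del: index_mult_mat_vec)
  also have "\<dots> = (\<Sum>l<n. \<Sum>i<m. A $$ (i, l) * x $ l * cnj (y $ i))" by (rule sum.swap)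
  also have "\<dots> = x \<bullet>c (mat_adjoint A *\<^sub>v y)"
    using assms by (auto simp: cscalar_prod_sum mat_vec_index_sum sum_distrib_left mult_ac
        simp del: index_mult_mat_vec intro!: sum.cong)
  finally show ?thesis .
qed

lemma vec_norm_nonneg [simp]: "vec_norm v \<ge> 0"
  by (simp add: vec_norm_def L2_set_nonneg)

lemma vec_norm_square: "complex_of_real ((vec_norm v)\<^sup>2) = v \<bullet>c v"
  by (simp add: vec_norm_def L2_set_def cscalar_prod_sum sum_nonneg complex_norm_square del: of_real_power)

lemma vec_norm_eq_0: "v \<in> carrier_vec n \<Longrightarrow> vec_norm v = 0 \<longleftrightarrow> v = 0\<^sub>v n"
  by (simp add: vec_norm_square[symmetric] flip: conjugate_square_eq_0_vec)

lemma normalise_cscalar: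
  assumes "v \<in> carrier_vec n" "w \<in> carrier_vec n"
  shows "normalise v \<bullet>c normalise w = complex_of_real (1 / (vec_norm v * vec_norm w)) * (v \<bullet>c w)"
  using assms by (simp add: normalise_def cscalar_prod_sum sum_distrib_left sum_divide_distrib mult_ac)

lemma normalise_carrier [simp]: "v \<in> carrier_vec n \<Longrightarrow> normalise v \<in> carrier_vec n"
  by (simp add: normalise_def)

lemma normalise_self:
  assumes "v \<in> carrier_vec n" "v \<noteq> 0\<^sub>v n"
  shows "normalise v \<bullet>c normalise v = 1"
  unfolding normalise_cscalar[OF assms(1,1)] vec_norm_square[of v, symmetric]
  using assms vec_norm_eq_0[OF assms(1)] by (simp add: power2_eq_square)

section \<open>Unitary matrices and the spectral theorem\<close>

definition unitary_mat :: "nat \<Rightarrow> complex mat \<Rightarrow> bool" where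
  "unitary_mat n U \<longleftrightarrow> U \<in> carrier_mat n n \<and> mat_adjoint U * U = 1\<^sub>m n"

lemma unitary_matD:
  assumes "unitary_mat n U"
  shows "U \<in> carrier_mat n n" "mat_adjoint U * U = 1\<^sub>m n" "U * mat_adjoint U = 1\<^sub>m n"
  using assms mat_mult_left_right_inverse[of "mat_adjoint U" n U] by (auto simp: unitary_mat_def)

lemma unitary_mat_mult:
  assumes "unitary_mat n U" "unitary_mat n V"
  shows "unitary_mat n (U * V)"
proof -
  note U = unitary_matD[OF assms(1)] and V = unitary_matD[OF assms(2)]
  have "mat_adjoint (U * V) * (U * V) = mat_adjoint V * (mat_adjoint U * U) * V"
    using U(1) V(1) by (simp add: mat_adjoint_mult[of U V] assoc_mult_mat[of _ n n _ n _ n])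
  thus ?thesis using U V by (simp add: unitary_mat_def)
qed

text \<open>The vector is completed to a basis and orthogonalised; Gram-Schmidt keeps its first
  vector, and normalising all columns turns orthogonality into unitarity.\<close>

lemma unitary_mat_first_column:
  assumes v: "v \<in> carrier_vec n" "v \<noteq> 0\<^sub>v n"
  shows "\<exists>W. unitary_mat n W \<and> col W 0 = normalise v"
proof -
  interpret cof_vec_space n "TYPE(complex)" .
  define b where "b = basis_completion v"
  define ws where "ws = gram_schmidt n b"
  from basis_completion[OF v, folded b_def]
  have dist_b: "distinct b" and indep: "\<not> lin_dep (set b)" and b: "set b \<subseteq> carrier_vec n"
    and hdb: "hd b = v" and len_b: "length b = n" by auto
  have n: "n > 0" using v by (cases n) auto
  obtain vs where bv: "b = v # vs" using hdb len_b n by (cases b) auto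
  from gram_schmidt_result[OF b dist_b indep refl, folded ws_def]
  have ws: "set ws \<subseteq> carrier_vec n" "corthogonal ws" "length ws = n" by (auto simp: len_b)
  have wsi: "ws ! i \<in> carrier_vec n" if "i < n" for i using ws that by auto
  have "hd ws = v" using gram_schmidt_hd[OF v(1), of vs, folded bv] unfolding ws_def .
  hence ws0: "ws ! 0 = v" using ws n by (cases ws) auto
  define W where "W = mat_of_cols n (map normalise ws)"
  have W: "W \<in> carrier_mat n n" using ws by (simp add: W_def carrier_matI)
  have colW: "col W i = normalise (ws ! i)" if "i < n" for i
    unfolding W_def using ws that wsi[OF that] by (subst col_mat_of_cols) auto
  have orth: "ws ! i \<bullet>c ws ! j = 0 \<longleftrightarrow> i \<noteq> j" if "i < n" "j < n" for i j
    using ws that by (auto simp: corthogonal_def)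
  have "mat_adjoint W * W = 1\<^sub>m n"
  proof (rule eq_matI)
    fix i j assume ij: "i < dim_row (1\<^sub>m n)" "j < dim_col (1\<^sub>m n)"
    have "(mat_adjoint W * W) $$ (i, j) = normalise (ws ! j) \<bullet>c normalise (ws ! i)"
      using ij W by (subst mat_adjoint_mult_index) (auto simp: colW)
    also have "\<dots> = (if i = j then 1 else 0)"
    proof (cases "i = j")
      case True
      have "ws ! i \<noteq> 0\<^sub>v n" using orth[of i i] wsi[of i] ij by auto
      thus ?thesis using True normalise_self[of "ws ! i" n] wsi[of i] ij by simp
    next
      case False
      thus ?thesis using orth[of j i] wsi ij by (simp add: normalise_cscalar[of _ n])
    qed
    finally show "(mat_adjoint W * W) $$ (i, j) = 1\<^sub>m n $$ (i, j)" using ij by simp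
  qed (use W in auto)
  thus ?thesis using W colW[OF n] ws0 by (auto simp: unitary_mat_def)
qed

lemma mat_adjoint_four_block:
  fixes A B C D :: "complex mat"
  assumes "A \<in> carrier_mat n1 m1" "B \<in> carrier_mat n1 m2" "C \<in> carrier_mat n2 m1" "D \<in> carrier_mat n2 m2"
  shows "mat_adjoint (four_block_mat A B C D) =
    four_block_mat (mat_adjoint A) (mat_adjoint C) (mat_adjoint B) (mat_adjoint D)"
  by (rule eq_matI) (use assms in \<open>auto simp: four_block_mat_def Let_def\<close>)

lemma unitary_similarity:
  fixes A B :: "complex mat"
  assumes U: "unitary_mat n U" and "A \<in> carrier_mat n n" "B = mat_adjoint U * A * U"
  shows "A = U * B * mat_adjoint U"
proof -
  note U = unitary_matD[OF U]
  have "U * B * mat_adjoint U = (U * mat_adjoint U) * A * (U * mat_adjoint U)"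
    unfolding assms(3) using U(1) assms(2) by (simp add: assoc_mult_mat[of _ n n _ n _ n])
  thus ?thesis using U assms(2) by simp
qed

text \<open>Deflation by induction on the list of roots. A unitary \<open>W\<close> whose first
  column is an eigenvector for the head \<open>e\<close> makes the first column of \<open>B\<close>
  equal to e times a unit vector; since \<open>B\<close> is Hermitian, its first row vanishes off
  the diagonal too, and the remaining block \<open>C\<close> inherits the other roots. The order of
  \<open>es\<close> is prescribed from outside, which later lets the diagonal be matched with the
  given decreasing eigenvalues.\<close>

lemma hermitian_diagonalisation:
  assumes "A \<in> carrier_mat n n" "mat_adjoint A = A" "char_poly A = (\<Prod>e\<leftarrow>es. [:- e, 1:])"
  shows "\<exists>U. unitary_mat n U \<and> A = U * mat_diag n ((!) es) * mat_adjoint U"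
  using assms
proof (induction es arbitrary: n A)
  case Nil
  have "n = 0" using degree_monic_char_poly[OF Nil(1)] Nil(3) by simp
  thus ?case using Nil by (auto intro!: exI[of _ "1\<^sub>m 0"] eq_matI simp: unitary_mat_def)
next
  case (Cons e es)
  note A = Cons.prems(1)
  obtain m where n: "n = Suc m"
  proof (cases n)
    case 0
    have "degree (char_poly A) = 0" using degree_monic_char_poly[OF A] 0 by simp
    moreover have "char_poly A = [:-e, 1:] * (\<Prod>e\<leftarrow>es. [:- e, 1:])" using Cons.prems(3) by simp
    moreover have "monic (\<Prod>e\<leftarrow>es. [:- e, 1:])" by (rule monic_prod_list) auto
    hence "degree ([:-e, 1:] * (\<Prod>e\<leftarrow>es. [:- e, 1:])) = Suc (degree (\<Prod>e\<leftarrow>es. [:- e, 1:]))"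
      by (subst degree_mult_eq) auto
    ultimately show thesis by simp
  qed
  have "eigenvalue A e"
    unfolding eigenvalue_root_char_poly[OF A] Cons.prems(3) by simp
  then obtain v where "eigenvector A v e" by (auto simp: eigenvalue_def)
  hence v: "v \<in> carrier_vec n" "v \<noteq> 0\<^sub>v n" "A *\<^sub>v v = e \<cdot>\<^sub>v v"
    using A by (auto simp: eigenvector_def)
  obtain W where W: "unitary_mat n W" and W0: "col W 0 = normalise v"
    using unitary_mat_first_column[OF v(1,2)] by auto
  note Wc = unitary_matD[OF W]
  note Wa = mat_adjoint_carrier[OF Wc(1)]
  have n0: "0 < n" by (simp add: n)
  define B where "B = mat_adjoint W * A * W"
  have B: "B \<in> carrier_mat n n" using A Wc(1) by (simp add: B_def)
  have AB: "A = W * B * mat_adjoint W" by (rule unitary_similarity[OF W A B_def])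
  have Bherm: "mat_adjoint B = B"
    unfolding B_def using A Wc(1) Cons.prems(2)
    by (simp add: mat_adjoint_mult assoc_mult_mat[of _ n n _ n _ n])
  have B0: "B $$ (i, 0) = (if i = 0 then e else 0)" if i: "i < n" for i
  proof -
    have "col B 0 = mat_adjoint W *\<^sub>v (A *\<^sub>v col W 0)"
      unfolding B_def using A Wc(1) n
      by (simp only: assoc_mult_mat[of _ n n _ n _ n] col_mult2[of _ n n _ n] mat_adjoint_carrier
          mult_square_carrier zero_less_Suc)
    also have "A *\<^sub>v col W 0 = e \<cdot>\<^sub>v col W 0"
      unfolding W0 normalise_def using v A by (simp add: mult_mat_vec[of A n n v] smult_smult_assoc mult.commute)
    also have "mat_adjoint W *\<^sub>v (e \<cdot>\<^sub>v col W 0) = e \<cdot>\<^sub>v col (mat_adjoint W * W) 0"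
      by (simp only: mult_mat_vec[OF Wa col_carrier_vec[OF n0 Wc(1)]] col_mult2[OF Wa Wc(1) n0])
    also have "\<dots> = e \<cdot>\<^sub>v unit_vec n 0" using Wc(2) n by simp
    finally have "col B 0 $ i = (e \<cdot>\<^sub>v unit_vec n 0) $ i" by simp
    thus ?thesis using i B n by simp
  qed
  have B0': "B $$ (0, i) = (if i = 0 then e else 0)" if i: "i < n" for i
  proof (cases "i = 0")
    case False
    have "B $$ (0, i) = cnj (B $$ (i, 0))"
      using mat_adjoint_index[of 0 B i] B i n unfolding Bherm by simp
    thus ?thesis using B0[OF i] False by simp
  qed (use B0 n in simp)
  define E where "E = mat 1 1 (\<lambda>_. e)"
  define C where "C = mat m m (\<lambda>(i, j). B $$ (Suc i, Suc j))"
  have E: "E \<in> carrier_mat 1 1" and C: "C \<in> carrier_mat m m" by (auto simp: E_def C_def)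
  have Bblock: "B = four_block_mat E (0\<^sub>m 1 m) (0\<^sub>m m 1) C"
  proof (rule eq_matI)
    fix i j
    assume "i < dim_row (four_block_mat E (0\<^sub>m 1 m) (0\<^sub>m m 1) C)" "j < dim_col (four_block_mat E (0\<^sub>m 1 m) (0\<^sub>m m 1) C)"
    hence "i < n" "j < n" using E C n by auto
    thus "B $$ (i, j) = four_block_mat E (0\<^sub>m 1 m) (0\<^sub>m m 1) C $$ (i, j)"
      using B0[of i] B0'[of j] n by (cases i; cases j) (auto simp: E_def C_def)
  qed (use B E C n in auto)
  have Cherm: "mat_adjoint C = C"
  proof (rule eq_matI)
    fix i j assume "i < dim_row C" "j < dim_col C"
    thus "mat_adjoint C $$ (i, j) = C $$ (i, j)"
      using mat_adjoint_index[of "Suc i" B "Suc j"] B n unfolding Bherm by (simp add: C_def)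
  qed (use C in auto)
  have "similar_mat B A"
    unfolding similar_mat_def
    by (rule exI[of _ "mat_adjoint W"], rule exI[of _ W], rule similar_mat_witI[of _ _ n])
       (use Wc A B in \<open>auto simp: B_def\<close>)
  hence "char_poly B = [:- e, 1:] * (\<Prod>e\<leftarrow>es. [:- e, 1:])"
    using Cons.prems(3) char_poly_similar by fastforce
  moreover have "char_poly B = char_poly E * char_poly C"
    unfolding Bblock by (rule char_poly_four_block_zeros_col[OF E _ C]) simp
  moreover have "char_poly E = [:- e, 1:]"
    by (simp add: E_def char_poly_defs det_def sign_def)
  \<comment> \<open>Cancelling the linear factor of \<open>e\<close> leaves exactly the tail of the
    list for the block \<open>C\<close>.\<close>
  ultimately have "char_poly C = (\<Prod>e\<leftarrow>es. [:- e, 1:])"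
    by (metis mult_cancel_left pCons_eq_0_iff zero_neq_one)
  from Cons.IH[OF C Cherm this] obtain V where
    V: "unitary_mat m V" "C = V * mat_diag m ((!) es) * mat_adjoint V" by auto
  note Vc = unitary_matD[OF V(1)]
  \<comment> \<open>\<open>V\<close> is extended by 1 so that it leaves the eigenvector already
    found alone; \<open>W * X\<close> is the diagonalising unitary.\<close>
  define X where "X = four_block_mat (1\<^sub>m 1) (0\<^sub>m 1 m) (0\<^sub>m m 1) V"
  have X: "X \<in> carrier_mat n n" 
    using four_block_carrier_mat[OF one_carrier_mat[of 1] Vc(1)] by (simp add: X_def n)
  have Xadj: "mat_adjoint X = four_block_mat (1\<^sub>m 1) (0\<^sub>m 1 m) (0\<^sub>m m 1) (mat_adjoint V)"
    unfolding X_def using Vc(1)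
    by (subst mat_adjoint_four_block[of _ 1 1 _ m _ m]) (auto intro!: arg_cong2[of _ _ _ _ "\<lambda>b c. four_block_mat _ b c _"] eq_matI)
  have block_mult: "four_block_mat P (0\<^sub>m 1 m) (0\<^sub>m m 1) R * four_block_mat P' (0\<^sub>m 1 m) (0\<^sub>m m 1) R' =
      four_block_mat (P * P') (0\<^sub>m 1 m) (0\<^sub>m m 1) (R * R')"
    if P: "P \<in> carrier_mat 1 1" "P' \<in> carrier_mat 1 1" and R: "R \<in> carrier_mat m m" "R' \<in> carrier_mat m m"
    for P P' R R' :: "complex mat"
  proof -
    have "P * P' + 0\<^sub>m 1 m * 0\<^sub>m m 1 = P * P'" "P * 0\<^sub>m 1 m + 0\<^sub>m 1 m * R' = 0\<^sub>m 1 m"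
      "0\<^sub>m m 1 * P' + R * 0\<^sub>m m 1 = 0\<^sub>m m 1" "0\<^sub>m m 1 * 0\<^sub>m 1 m + R * R' = R * R'"
      using P R by (auto simp: carrier_matD)
    thus ?thesis
      using mult_four_block_mat[OF P(1) zero_carrier_mat zero_carrier_mat R(1) P(2) zero_carrier_mat zero_carrier_mat R(2)]
      by simp
  qed
  note Va = mat_adjoint_carrier[OF Vc(1)] and one1 = one_carrier_mat[of 1]
  have "mat_adjoint X * X = four_block_mat (1\<^sub>m 1) (0\<^sub>m 1 m) (0\<^sub>m m 1) (1\<^sub>m m)"
    unfolding Xadj unfolding X_def block_mult[OF one1 one1 Va Vc(1)] Vc(2) by simp
  also have "\<dots> = 1\<^sub>m n"
    unfolding four_block_one_mat by (simp add: n)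
  finally have XU: "unitary_mat n X" using X by (simp add: unitary_mat_def)
  define D where "D = mat_diag m ((!) es)"
  have Dc: "D \<in> carrier_mat m m" by (simp add: D_def)
  have diag: "mat_diag n ((!) (e # es)) = four_block_mat E (0\<^sub>m 1 m) (0\<^sub>m m 1) D"
    by (rule eq_matI) (auto simp: n mat_diag_def E_def D_def four_block_mat_def Let_def nth_Cons')
  have BX: "B = X * mat_diag n ((!) (e # es)) * mat_adjoint X"
    unfolding Xadj diag unfolding X_def block_mult[OF one1 E Vc(1) Dc]
      block_mult[OF mult_square_carrier[OF one1 E] one1 mult_square_carrier[OF Vc(1) Dc] Va]
    unfolding left_mult_one_mat[OF E] right_mult_one_mat[OF E] Bblock V(2) D_def ..
  have "A = W * (X * mat_diag n ((!) (e # es)) * mat_adjoint X) * mat_adjoint W"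
    using AB unfolding BX .
  also have "\<dots> = (W * X) * mat_diag n ((!) (e # es)) * mat_adjoint (W * X)"
    using Wc(1) X by (simp add: mat_adjoint_mult assoc_mult_mat[of _ n n _ n _ n])
  finally show ?case using unitary_mat_mult[OF W XU] by blast
qed

section \<open>Functions of a diagonalised matrix: square root and inverse\<close>

lemma dim_mat_diag [simp]: "dim_row (mat_diag n f) = n" "dim_col (mat_diag n f) = n"
  by (simp_all add: mat_diag_def)

lemma mat_diag_mult_vec_index:
  fixes f :: "nat \<Rightarrow> complex"
  assumes "y \<in> carrier_vec n" "i < n"
  shows "(mat_diag n f *\<^sub>v y) $ i = f i * y $ i"
proof -
  have "(mat_diag n f *\<^sub>v y) $ i = (\<Sum>l<n. mat_diag n f $$ (i, l) * y $ l)"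
    using assms by (subst mat_vec_index_sum) auto
  also have "\<dots> = (\<Sum>l<n. if l = i then f i * y $ i else 0)"
    using assms by (intro sum.cong) (auto simp: mat_diag_def)
  finally show ?thesis using assms by simp
qed

lemma diag_conj_column:
  assumes U: "unitary_mat n U" and i: "i < n"
  shows "(U * mat_diag n f * mat_adjoint U) *\<^sub>v col U i = f i \<cdot>\<^sub>v col U i"
proof -
  note Uc = unitary_matD[OF U]
  have "(U * mat_diag n f * mat_adjoint U) * U = U * mat_diag n f * (mat_adjoint U * U)"
    using Uc(1) by (intro assoc_mult_mat[of _ n n _ n _ n]) auto
  also have "\<dots> = U * mat_diag n f" using Uc by (simp add: right_mult_one_mat[of _ n n])
  also have "\<dots> = mat n n (\<lambda>(r, j). U $$ (r, j) * f j)" by (rule mat_diag_mult_right[OF Uc(1)])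
  finally have eq: "(U * mat_diag n f * mat_adjoint U) * U = mat n n (\<lambda>(r, j). U $$ (r, j) * f j)" .
  have "(U * mat_diag n f * mat_adjoint U) *\<^sub>v col U i = col ((U * mat_diag n f * mat_adjoint U) * U) i"
    using Uc(1) i by (intro col_mult2[symmetric, of _ n n _ n]) auto
  also have "\<dots> = f i \<cdot>\<^sub>v col U i"
    unfolding eq using Uc(1) i by (intro eq_vecI) (auto simp: mult.commute)
  finally show ?thesis .
qed

lemma unitary_column_self:
  assumes "unitary_mat n U" "i < n"
  shows "col U i \<bullet>c col U i = 1"
  using mat_adjoint_mult_index[of U U i i] unitary_matD[OF assms(1)] assms(2) by simp

lemma diag_conj_mult:
  assumes U: "unitary_mat n U"
  shows "(U * mat_diag n f * mat_adjoint U) * (U * mat_diag n g * mat_adjoint U) =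
    U * mat_diag n (\<lambda>i. f i * g i) * mat_adjoint U"
proof -
  note Uc = unitary_matD[OF U] and D = mat_diag_dim[of n f] mat_diag_dim[of n g]
  note Ua = mat_adjoint_carrier[OF Uc(1)]
  have "(U * mat_diag n f * mat_adjoint U) * (U * mat_diag n g * mat_adjoint U) =
    U * mat_diag n f * (mat_adjoint U * U) * mat_diag n g * mat_adjoint U"
    using Uc(1) D by (simp add: assoc_mult_mat[of _ n n _ n _ n])
  also have "\<dots> = U * (mat_diag n f * mat_diag n g) * mat_adjoint U"
    unfolding Uc(2) using Uc(1) D
    by (simp add: assoc_mult_mat[of _ n n _ n _ n] left_mult_one_mat[of _ n n] del: mat_diag_diag)
  finally show ?thesis by simp
qed

lemma diag_conj_adjoint:
  assumes U: "unitary_mat n U"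
  shows "mat_adjoint (U * mat_diag n f * mat_adjoint U) = U * mat_diag n (\<lambda>i. cnj (f i)) * mat_adjoint U"
proof -
  note Uc = unitary_matD[OF U] and D = mat_diag_dim[of n f] mat_diag_dim[of n "\<lambda>i. cnj (f i)"]
  have "mat_adjoint (U * mat_diag n f * mat_adjoint U) = mat_adjoint (mat_adjoint U) * mat_adjoint (U * mat_diag n f)"
    using Uc(1) D by (intro mat_adjoint_mult) auto
  also have "mat_adjoint (U * mat_diag n f) = mat_adjoint (mat_diag n f) * mat_adjoint U"
    using Uc(1) D by (intro mat_adjoint_mult) auto
  finally show ?thesis using Uc(1) D by (simp add: mat_adjoint_diag assoc_mult_mat[of _ n n _ n _ n])
qed

text \<open>With y = U^* x the form is the sum of d_i |y_i|^2, and y is nonzero because U is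
  invertible.\<close>

lemma hermitian_pos_def_diag_conj:
  assumes U: "unitary_mat n U" and d: "\<And>i. i < n \<Longrightarrow> d i > 0"
  shows "hermitian_pos_def n (U * mat_diag n (\<lambda>i. complex_of_real (d i)) * mat_adjoint U)"
  unfolding hermitian_pos_def_def
proof (intro conjI ballI impI)
  let ?D = "mat_diag n (\<lambda>i. complex_of_real (d i))"
  note Uc = unitary_matD[OF U] and D = mat_diag_dim[of n "\<lambda>i. complex_of_real (d i)"]
  note Ua = mat_adjoint_carrier[OF Uc(1)]
  show "U * ?D * mat_adjoint U \<in> carrier_mat n n" using Uc(1) D by simp
  show "mat_adjoint (U * ?D * mat_adjoint U) = U * ?D * mat_adjoint U"
    by (simp add: diag_conj_adjoint[OF U])
  fix x :: "complex vec" assume x: "x \<in> carrier_vec n" "x \<noteq> 0\<^sub>v n"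
  define y where "y = mat_adjoint U *\<^sub>v x"
  have y: "y \<in> carrier_vec n" using Ua x unfolding y_def by (intro mult_mat_vec_carrier)
  have "U *\<^sub>v y = x"
    unfolding y_def using Uc x assoc_mult_mat_vec[OF Uc(1) Ua x(1)] by simp
  hence "y \<noteq> 0\<^sub>v n" using x(2) Uc(1) by auto
  then obtain j where j: "j < n" "y $ j \<noteq> 0" using y by (metis eq_vecI carrier_vecD index_zero_vec)
  have "U * ?D * mat_adjoint U *\<^sub>v x = U *\<^sub>v (?D *\<^sub>v y)"
    unfolding y_def
    using assoc_mult_mat_vec[OF mult_square_carrier[OF Uc(1) D] Ua x(1)]
      assoc_mult_mat_vec[OF Uc(1) D y] by (simp add: y_def)
  hence "(U * ?D * mat_adjoint U *\<^sub>v x) \<bullet>c x = (?D *\<^sub>v y) \<bullet>c y"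
    using mult_mat_vec_cscalar[OF Uc(1) mult_mat_vec_carrier[OF D y] x(1)] by (simp add: y_def)
  also have "\<dots> = (\<Sum>i<n. complex_of_real (d i) * y $ i * cnj (y $ i))"
  proof -
    have "(?D *\<^sub>v y) $ i = complex_of_real (d i) * y $ i" if "i < n" for i
      by (rule mat_diag_mult_vec_index[OF y that])
    thus ?thesis using y by (simp add: cscalar_prod_sum)
  qed
  also have "\<dots> = complex_of_real (\<Sum>i<n. d i * (cmod (y $ i))\<^sup>2)"
    by (simp add: complex_norm_square mult.assoc del: of_real_power)
  finally have "Re ((U * ?D * mat_adjoint U *\<^sub>v x) \<bullet>c x) = (\<Sum>i<n. d i * (cmod (y $ i))\<^sup>2)"
    by simp
  also have "\<dots> > 0"
    by (rule sum_pos2[of _ j]) (use j d in \<open>auto simp: less_imp_le\<close>)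
  finally show "0 < Re ((U * ?D * mat_adjoint U *\<^sub>v x) \<bullet>c x)" .
qed

text \<open>\<open>f i\<close> is the Rayleigh quotient at the unit eigenvector
  \<open>col U i\<close>; positivity is the definition applied there, and moving \<open>A\<close>
  across the inner product shows that the value equals its conjugate.\<close>

lemma hermitian_pos_def_eigenvalues:
  assumes A: "hermitian_pos_def n A" "A = U * mat_diag n f * mat_adjoint U" and U: "unitary_mat n U"
    and i: "i < n"
  shows "Re (f i) > 0" "Im (f i) = 0"
proof -
  note Uc = unitary_matD[OF U]
  have c: "col U i \<in> carrier_vec n" using Uc(1) i by auto
  have s: "(A *\<^sub>v col U i) \<bullet>c col U i = f i"
    unfolding A(2) diag_conj_column[OF U i] using unitary_column_self[OF U i] c by simp
  have "col U i \<noteq> 0\<^sub>v n" using unitary_column_self[OF U i] by auto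
  thus "Re (f i) > 0" using A(1) c s unfolding hermitian_pos_def_def by force
  have "(A *\<^sub>v col U i) \<bullet>c col U i = col U i \<bullet>c (A *\<^sub>v col U i)"
    using mult_mat_vec_cscalar[of A n n "col U i" "col U i"] A(1) c unfolding hermitian_pos_def_def by simp
  also have "\<dots> = cnj (f i)"
    unfolding A(2) diag_conj_column[OF U i] using unitary_column_self[OF U i] c
    by (simp add: conjugate_smult_vec)
  finally show "Im (f i) = 0" using s by (simp add: complex_eq_iff)
qed

lemma hermitian_pos_def_diagonalisation:
  assumes A: "hermitian_pos_def n A"
  obtains U d where "unitary_mat n U" "\<And>i. i < n \<Longrightarrow> d i > 0"
    "A = U * mat_diag n (\<lambda>i. complex_of_real (d i)) * mat_adjoint U"
proof -
  have c: "A \<in> carrier_mat n n" "mat_adjoint A = A" using A by (auto simp: hermitian_pos_def_def)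
  obtain es where "char_poly A = (\<Prod>e\<leftarrow>es. [:- e, 1:])"
    using char_poly_factorized[OF c(1)] by auto
  from hermitian_diagonalisation[OF c this] obtain U where
    U: "unitary_mat n U" "A = U * mat_diag n ((!) es) * mat_adjoint U" by auto
  note ev = hermitian_pos_def_eigenvalues[OF A U(2,1)]
  have "mat_diag n ((!) es) = mat_diag n (\<lambda>i. complex_of_real (Re (es ! i)))"
    by (rule eq_matI) (use ev in \<open>auto simp: mat_diag_def complex_eq_iff\<close>)
  thus thesis using that[of U "\<lambda>i. Re (es ! i)"] U ev by simp
qed

text \<open>\<open>mat_sqrt\<close> is a definite description, so uniqueness carries the proof. If T
  is a positive definite root and A u = r^2 u with r > 0, then v = T u - r u satisfies T v = -r v,
  which positivity of T excludes unless v = 0. Hence T and the candidate agree on every column of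
  U.\<close>

lemma mat_sqrt_diag_conj:
  assumes U: "unitary_mat n U" and d: "\<And>i. i < n \<Longrightarrow> d i > 0"
  shows "mat_sqrt (U * mat_diag n (\<lambda>i. complex_of_real (d i)) * mat_adjoint U) =
    U * mat_diag n (\<lambda>i. complex_of_real (sqrt (d i))) * mat_adjoint U" (is "mat_sqrt ?A = ?S")
proof -
  note Uc = unitary_matD[OF U]
  have dim: "dim_row ?A = n" using Uc(1) by simp
  have diag: "mat_diag n (\<lambda>i. complex_of_real (sqrt (d i)) * complex_of_real (sqrt (d i))) =
    mat_diag n (\<lambda>i. complex_of_real (d i))"
    by (rule eq_matI) (use d in \<open>auto simp: mat_diag_def less_imp_le simp flip: of_real_mult\<close>)
  have S: "hermitian_pos_def n ?S" "?S * ?S = ?A"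
    using hermitian_pos_def_diag_conj[OF U, of "\<lambda>i. sqrt (d i)"] d
    by (simp_all add: diag_conj_mult[OF U] diag)
  have unique: "T = ?S" if T: "hermitian_pos_def n T" "T * T = ?A" for T
  proof -
    have Tc: "T \<in> carrier_mat n n" using T by (simp add: hermitian_pos_def_def)
    have col: "T *\<^sub>v col U i = complex_of_real (sqrt (d i)) \<cdot>\<^sub>v col U i" if i: "i < n" for i
    proof (rule ccontr)
      define r where "r = complex_of_real (sqrt (d i))"
      define u where "u = col U i"
      have u: "u \<in> carrier_vec n" using Uc(1) i by (auto simp: u_def)
      have Tu: "T *\<^sub>v u \<in> carrier_vec n" using Tc u by simp
      have TTu: "T *\<^sub>v (T *\<^sub>v u) = (r * r) \<cdot>\<^sub>v u"
        using assoc_mult_mat_vec[OF Tc Tc u] diag_conj_column[OF U i, of "\<lambda>i. complex_of_real (d i)"] d[OF i]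
        unfolding T(2) u_def r_def by (simp flip: of_real_mult)
      define v where "v = T *\<^sub>v u - r \<cdot>\<^sub>v u"
      have v: "v \<in> carrier_vec n" using Tu u by (simp add: v_def)
      assume "T *\<^sub>v col U i \<noteq> complex_of_real (sqrt (d i)) \<cdot>\<^sub>v col U i"
      hence ne: "T *\<^sub>v u \<noteq> r \<cdot>\<^sub>v u" by (simp add: u_def r_def)
      have "v \<noteq> 0\<^sub>v n"
      proof
        assume v0: "v = 0\<^sub>v n"
        have "(T *\<^sub>v u) $ j = (r \<cdot>\<^sub>v u) $ j" if "j < n" for j
        proof -
          have "v $ j = (T *\<^sub>v u) $ j - (r \<cdot>\<^sub>v u) $ j"
            unfolding v_def using u that by (intro index_minus_vec) auto
          thus ?thesis using v0 that by simp
        qed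
        hence "T *\<^sub>v u = r \<cdot>\<^sub>v u" using Tu u Tc by (intro eq_vecI) auto
        with ne show False ..
      qed
      have "T *\<^sub>v v = T *\<^sub>v (T *\<^sub>v u) - T *\<^sub>v (r \<cdot>\<^sub>v u)"
        unfolding v_def using Tc Tu u by (intro mult_minus_distrib_mat_vec) auto
      also have "\<dots> = (- r) \<cdot>\<^sub>v v"
        unfolding TTu mult_mat_vec[OF Tc u] v_def using Tu u Tc
        by (intro eq_vecI) (auto simp: algebra_simps)
      finally have "(T *\<^sub>v v) \<bullet>c v = - r * (v \<bullet>c v)" using v by simp
      hence "Re ((T *\<^sub>v v) \<bullet>c v) = - (sqrt (d i) * (vec_norm v)\<^sup>2)"
        unfolding vec_norm_square[symmetric] r_def by simp
      moreover have "sqrt (d i) * (vec_norm v)\<^sup>2 \<ge> 0" using d[OF i] by simp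
      moreover have "Re ((T *\<^sub>v v) \<bullet>c v) > 0"
        using T(1) v \<open>v \<noteq> 0\<^sub>v n\<close> by (simp add: hermitian_pos_def_def)
      ultimately show False by linarith
    qed
    have Sc: "?S \<in> carrier_mat n n" using Uc(1) by simp
    have "T * U = ?S * U"
    proof (rule mat_col_eqI)
      fix i assume "i < dim_col (?S * U)"
      hence i: "i < n" using Uc(1) by simp
      show "col (T * U) i = col (?S * U) i"
        unfolding col_mult2[OF Tc Uc(1) i] col_mult2[OF Sc Uc(1) i] col[OF i] diag_conj_column[OF U i] ..
    qed (use Tc Sc Uc(1) in auto)
    hence "T * U * mat_adjoint U = ?S * U * mat_adjoint U" by simp
    thus ?thesis
      unfolding assoc_mult_mat[OF Tc Uc(1) mat_adjoint_carrier[OF Uc(1)]]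
        assoc_mult_mat[OF Sc Uc(1) mat_adjoint_carrier[OF Uc(1)]] Uc(3)
        right_mult_one_mat[OF Tc] right_mult_one_mat[OF Sc] .
  qed
  show ?thesis
    unfolding mat_sqrt_def dim by (rule the_equality, rule conjI[OF S], erule conjE, rule unique)
qed

text \<open>\<open>mat_inv\<close> unwraps an option, so \<open>mat_inverse A\<close> must first be
  shown to be a \<open>Some\<close>; the invertibility of \<open>A\<close> excludes
  \<open>None\<close>. The value is then identified by uniqueness of inverses.\<close>

lemma mat_inv_eqI:
  assumes A: "A \<in> carrier_mat n n" and B: "B \<in> carrier_mat n n" and AB: "A * B = 1\<^sub>m n"
  shows "mat_inv A = B"
proof -
  have BA: "B * A = 1\<^sub>m n" by (rule mat_mult_left_right_inverse[OF A B AB])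
  have "A \<in> Units (ring_mat TYPE(complex) n ())"
    unfolding Units_def ring_mat_def using A B AB BA by auto
  then obtain C where C: "mat_inverse A = Some C"
    using mat_inverse(1)[OF A, of "()"] by (cases "mat_inverse A") auto
  from mat_inverse(2)[OF A C] have AC: "A * C = 1\<^sub>m n" "C \<in> carrier_mat n n" by auto
  have "C = (B * A) * C" using AC BA by simp
  also have "\<dots> = B" using A B AC by simp
  finally show ?thesis by (simp add: mat_inv_def C)
qed

lemma mat_inv_diag_conj:
  assumes U: "unitary_mat n U" and d: "\<And>i. i < n \<Longrightarrow> d i \<noteq> 0"
  shows "mat_inv (U * mat_diag n (\<lambda>i. complex_of_real (d i)) * mat_adjoint U) =
    U * mat_diag n (\<lambda>i. complex_of_real (1 / d i)) * mat_adjoint U"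
proof (rule mat_inv_eqI)
  note Uc = unitary_matD[OF U]
  have "mat_diag n (\<lambda>i. complex_of_real (d i) * complex_of_real (1 / d i)) = 1\<^sub>m n"
    by (rule eq_matI) (use d in \<open>auto simp: mat_diag_def\<close>)
  thus "U * mat_diag n (\<lambda>i. complex_of_real (d i)) * mat_adjoint U *
      (U * mat_diag n (\<lambda>i. complex_of_real (1 / d i)) * mat_adjoint U) = 1\<^sub>m n"
    unfolding diag_conj_mult[OF U] using Uc by simp
qed (use unitary_matD[OF U] in auto)

subsection \<open>The Arnoldi relation\<close>

text \<open>Linearity in the form that the Arnoldi steps provide: an expansion entry by entry, so
  that no sum of vectors has to be formed.\<close>

lemma cscalar_prod_expand:
  fixes w w' q :: "complex vec"
  assumes "\<And>r. r < n \<Longrightarrow> w $ r = w' $ r + (\<Sum>i<m. c i * v i $ r)"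
    and "q \<in> carrier_vec n"
  shows "w \<bullet>c q = w' \<bullet>c q + (\<Sum>i<m. c i * (v i \<bullet>c q))"
proof -
  have "w \<bullet>c q = (\<Sum>r<n. w' $ r * cnj (q $ r)) + (\<Sum>r<n. \<Sum>i<m. c i * (v i $ r * cnj (q $ r)))"
    using assms by (simp add: cscalar_prod_sum distrib_right sum.distrib sum_distrib_right mult.assoc)
  also have "(\<Sum>r<n. \<Sum>i<m. c i * (v i $ r * cnj (q $ r))) = (\<Sum>i<m. c i * (v i \<bullet>c q))"
    using assms(2) by (subst sum.swap) (simp add: cscalar_prod_sum sum_distrib_left)
  finally show ?thesis using assms(2) by (simp add: cscalar_prod_sum)
qed

definition orthonormal_list :: "nat \<Rightarrow> complex vec list \<Rightarrow> bool" where
  "orthonormal_list n qs \<longleftrightarrow> set qs \<subseteq> carrier_vec n \<and>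
     (\<forall>i<length qs. \<forall>j<length qs. qs ! i \<bullet>c qs ! j = (if i = j then 1 else 0))"

lemma cscalar_prod_zero_sym:
  fixes v w :: "complex vec"
  assumes "v \<in> carrier_vec n" "w \<in> carrier_vec n" "v \<bullet>c w = 0"
  shows "w \<bullet>c v = 0"
proof -
  have "w \<bullet>c v = cnj (v \<bullet>c w)"
    using assms(1,2) by (simp add: cscalar_prod_sum mult.commute)
  thus ?thesis using assms(3) by simp
qed

text \<open>The loop is modified Gram-Schmidt: each coefficient is taken with the current remainder.
  For orthonormal \<open>qs\<close> the parts already subtracted are orthogonal to the later
  vectors, so the coefficients agree with those of the original \<open>w\<close>. Orthogonality to
  the head survives the rest of the loop, since only multiples of vectors orthogonal to it are
  subtracted.\<close>

lemma orthogonalise_correct: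
  assumes "orthonormal_list n qs" "w \<in> carrier_vec n" "orthogonalise qs w = (hs, w')"
  shows "length hs = length qs \<and> w' \<in> carrier_vec n \<and>
    (\<forall>i<length qs. w' \<bullet>c qs ! i = 0) \<and> (\<forall>i<length qs. hs ! i = w \<bullet>c qs ! i) \<and>
    (\<forall>r<n. w $ r = w' $ r + (\<Sum>i<length qs. hs ! i * qs ! i $ r))"
  using assms
proof (induction qs arbitrary: w hs w')
  case Nil
  thus ?case by auto
next
  case (Cons q qs)
  have q: "q \<in> carrier_vec n" and qs: "\<And>i. i < length qs \<Longrightarrow> qs ! i \<in> carrier_vec n"
    using Cons.prems(1) by (auto simp: orthonormal_list_def)
  have orth: "(q # qs) ! i \<bullet>c (q # qs) ! j = (if i = j then 1 else 0)"
    if "i < Suc (length qs)" "j < Suc (length qs)" for i j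
    using Cons.prems(1) that by (simp add: orthonormal_list_def)
  have on: "orthonormal_list n qs"
    using Cons.prems(1) orth[of "Suc _" "Suc _"] by (auto simp: orthonormal_list_def)
  define h where "h = w \<bullet>c q"
  define v where "v = w - h \<cdot>\<^sub>v q"
  have v: "v \<in> carrier_vec n" using Cons.prems(2) q by (simp add: v_def)
  have vq: "v \<bullet>c x = w \<bullet>c x - h * (q \<bullet>c x)" if "x \<in> carrier_vec n" for x
    using Cons.prems(2) q that unfolding v_def
    by (simp add: minus_scalar_prod_distrib[of _ n])
  obtain hs' where hs': "orthogonalise qs v = (hs', w')" "hs = h # hs'"
    using Cons.prems(3) by (auto simp: Let_def v_def h_def split: prod.splits)
  note IH = Cons.IH[OF on v hs'(1)]
  have "w' \<bullet>c q = 0"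
  proof -
    have "v \<bullet>c q = w' \<bullet>c q + (\<Sum>i<length qs. hs' ! i * (qs ! i \<bullet>c q))"
      using IH q by (intro cscalar_prod_expand[of n]) auto
    also have "(\<Sum>i<length qs. hs' ! i * (qs ! i \<bullet>c q)) = 0"
      using orth[of "Suc _" 0] by (intro sum.neutral) auto
    finally show ?thesis using vq[OF q] orth[of 0 0] by (simp add: h_def)
  qed
  moreover have "hs ! i = w \<bullet>c (q # qs) ! i" if "i < Suc (length qs)" for i
    using that IH vq qs orth[of 0 i] by (cases i) (auto simp: hs'(2) h_def)
  moreover have "w $ r = w' $ r + (\<Sum>i<Suc (length qs). hs ! i * (q # qs) ! i $ r)" if "r < n" for r
    unfolding sum.lessThan_Suc_shift using IH that q Cons.prems(2)
    by (simp add: hs'(2) v_def algebra_simps)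
  ultimately show ?case using IH by (auto simp: hs'(2) nth_Cons split: nat.split)
qed

lemma arnoldi_basis_Suc:
  "\<exists>q. arnoldi_basis M b (Suc k) = arnoldi_basis M b k @ [q]"
  by (cases k) (auto simp: Let_def split: prod.split)

lemma length_arnoldi_basis [simp]: "length (arnoldi_basis M b k) = k"
proof (induction k)
  case (Suc k)
  thus ?case using arnoldi_basis_Suc[of M b k] by auto
qed simp

lemma arnoldi_basis_nth_mono:
  "i < j \<Longrightarrow> j \<le> k \<Longrightarrow> arnoldi_basis M b k ! i = arnoldi_basis M b j ! i"
proof (induction k)
  case (Suc k)
  thus ?case using arnoldi_basis_Suc[of M b k] by (cases "j = Suc k") (auto simp: nth_append)
qed simp

lemma last_arnoldi_basis: "j < k \<Longrightarrow> last (arnoldi_basis M b (Suc j)) = arnoldi_basis M b k ! j"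
  using arnoldi_basis_nth_mono[of j "Suc j" k M b]
  by (subst last_conv_nth) (auto simp flip: length_0_conv)

text \<open>Indices count from 0 here: number \<open>j\<close> is the inner loop for column j + 1 of
  the process. The list holds the entries of that column on and above the diagonal, the vector is
  the next basis vector before normalisation.\<close>

definition arnoldi_step :: "complex mat \<Rightarrow> complex vec \<Rightarrow> nat \<Rightarrow> complex list \<times> complex vec" where
  "arnoldi_step M b j = orthogonalise (arnoldi_basis M b (Suc j)) (M *\<^sub>v last (arnoldi_basis M b (Suc j)))"

lemma arnoldi_h_step:
  "arnoldi_h M b (Suc i) (Suc j) =
    (if i \<le> j then fst (arnoldi_step M b j) ! i
     else if i = Suc j then complex_of_real (vec_norm (snd (arnoldi_step M b j))) else 0)"
  by (simp add: arnoldi_h_def arnoldi_step_def Let_def split: prod.split)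

lemma arnoldi_basis_Suc_step:
  "arnoldi_basis M b (Suc (Suc j)) =
    arnoldi_basis M b (Suc j) @ [normalise (snd (arnoldi_step M b j))]"
  by (simp add: arnoldi_step_def Let_def split: prod.split)

lemma arnoldi_step_correct:
  assumes M: "M \<in> carrier_mat n n" and on: "orthonormal_list n (arnoldi_basis M b (Suc j))"
  defines "hs \<equiv> fst (arnoldi_step M b j)" and "w \<equiv> snd (arnoldi_step M b j)"
    and "qs \<equiv> arnoldi_basis M b (Suc j)"
  shows "w \<in> carrier_vec n" "\<And>i. i \<le> j \<Longrightarrow> w \<bullet>c qs ! i = 0"
    "\<And>r. r < n \<Longrightarrow> (M *\<^sub>v qs ! j) $ r = w $ r + (\<Sum>i\<le>j. hs ! i * qs ! i $ r)"
proof -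
  have last: "last qs = qs ! j" using last_arnoldi_basis[of j "Suc j" M b] by (simp add: qs_def)
  have "qs ! j \<in> carrier_vec n" using on unfolding qs_def orthonormal_list_def
    by (metis length_arnoldi_basis lessI nth_mem subsetD)
  hence "M *\<^sub>v qs ! j \<in> carrier_vec n" using M by simp
  moreover have "orthogonalise qs (M *\<^sub>v qs ! j) = (hs, w)"
    by (simp add: hs_def w_def arnoldi_step_def last qs_def[symmetric])
  ultimately have *: "length hs = length qs \<and> w \<in> carrier_vec n \<and>
    (\<forall>i<length qs. w \<bullet>c qs ! i = 0) \<and> (\<forall>i<length qs. hs ! i = (M *\<^sub>v qs ! j) \<bullet>c qs ! i) \<and>
    (\<forall>r<n. (M *\<^sub>v qs ! j) $ r = w $ r + (\<Sum>i<length qs. hs ! i * qs ! i $ r))"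
    using on orthogonalise_correct unfolding qs_def by blast
  have len: "length qs = Suc j" by (simp add: qs_def)
  show "w \<in> carrier_vec n" using * by blast
  show "\<And>i. i \<le> j \<Longrightarrow> w \<bullet>c qs ! i = 0" using * len by simp
  show "\<And>r. r < n \<Longrightarrow> (M *\<^sub>v qs ! j) $ r = w $ r + (\<Sum>i\<le>j. hs ! i * qs ! i $ r)"
    using * unfolding len lessThan_Suc_atMost by blast
qed

lemma arnoldi_reaches_mono: "arnoldi_reaches M b k \<Longrightarrow> j \<le> k \<Longrightarrow> arnoldi_reaches M b j"
  by (auto simp: arnoldi_reaches_def)

text \<open>\<open>arnoldi_reaches\<close> says that the remainders which get normalised do not
  vanish, as their norms are the subdiagonal entries.\<close>

lemma orthonormal_arnoldi_basis:
  assumes M: "M \<in> carrier_mat n n" and b: "b \<in> carrier_vec n" "b \<noteq> 0\<^sub>v n"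
  shows "arnoldi_reaches M b k \<Longrightarrow> orthonormal_list n (arnoldi_basis M b k)"
proof (induction k)
  case 0
  show ?case by (simp add: orthonormal_list_def)
next
  case (Suc k)
  have IH: "orthonormal_list n (arnoldi_basis M b k)"
    by (rule Suc.IH[OF arnoldi_reaches_mono[OF Suc.prems]]) simp
  show ?case
  proof (cases k)
    case 0
    thus ?thesis using b normalise_self[OF b] by (simp add: orthonormal_list_def)
  next
    case (Suc j)
    define w where "w = snd (arnoldi_step M b j)"
    define qs where "qs = arnoldi_basis M b k"
    note step = arnoldi_step_correct[OF M IH[unfolded Suc], folded w_def Suc, folded qs_def]
    have "arnoldi_h M b (Suc (Suc j)) (Suc j) \<noteq> 0"
      using Suc.prems Suc by (simp add: arnoldi_reaches_def)
    hence "vec_norm w \<noteq> 0" by (simp add: arnoldi_h_step w_def)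
    hence w0: "w \<noteq> 0\<^sub>v n" using vec_norm_eq_0[OF step(1)] by simp
    have len: "length qs = k" by (simp add: qs_def)
    have qs: "qs ! i \<in> carrier_vec n" if "i < k" for i
      using IH that unfolding orthonormal_list_def qs_def[symmetric] by (metis len nth_mem subsetD)
    have wq: "w \<bullet>c qs ! i = 0" "qs ! i \<bullet>c w = 0" if "i < k" for i
      using step(2)[of i] that Suc cscalar_prod_zero_sym[OF step(1) qs] by auto
    have nq: "normalise w \<bullet>c qs ! i = 0" "qs ! i \<bullet>c normalise w = 0" if "i < k" for i
      using wq[OF that] step(1) qs[OF that]
      by (auto simp: normalise_def conjugate_smult_vec)
    have "arnoldi_basis M b (Suc k) = qs @ [normalise w]"
      unfolding Suc arnoldi_basis_Suc_step by (simp add: w_def qs_def Suc)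
    moreover have "orthonormal_list n (qs @ [normalise w])"
      using IH step(1) nq normalise_self[OF step(1) w0]
      unfolding orthonormal_list_def qs_def[symmetric] len
      by (auto simp: nth_append len less_Suc_eq)
    ultimately show ?thesis by simp
  qed
qed

text \<open>The remainder \<open>w\<close> of the last column is kept unnormalised, so that a stop
  in step k, where \<open>w\<close> is zero, is included. Its orthogonality to Q will identify H
  with Q^* M Q; the Hessenberg shape feeds the determinant formula.\<close>

lemma arnoldi_relation:
  assumes M: "M \<in> carrier_mat n n" and b: "b \<in> carrier_vec n" "b \<noteq> 0\<^sub>v n"
    and k: "k \<ge> 1" and reach: "arnoldi_reaches M b k"
  defines "Q \<equiv> arnoldi_Q M b k" and "H \<equiv> arnoldi_H M b k"
  obtains w where "Q \<in> carrier_mat n k" "H \<in> carrier_mat k k" "mat_adjoint Q * Q = 1\<^sub>m k"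
    "w \<in> carrier_vec n" "mat_adjoint Q *\<^sub>v w = 0\<^sub>v k"
    "M * Q = Q * H + mat n k (\<lambda>(r, j). if j = k - 1 then w $ r else 0)"
    "\<And>i j. i < k \<Longrightarrow> j < k \<Longrightarrow> Suc j < i \<Longrightarrow> H $$ (i, j) = 0"
    "b = complex_of_real (vec_norm b) \<cdot>\<^sub>v col Q 0"
proof -
  define qs where "qs = arnoldi_basis M b k"
  have on: "orthonormal_list n qs"
    unfolding qs_def by (rule orthonormal_arnoldi_basis[OF M b reach])
  have len: "length qs = k" by (simp add: qs_def)
  have qs: "qs ! i \<in> carrier_vec n" if "i < k" for i
    using on that unfolding orthonormal_list_def by (metis len nth_mem subsetD)
  have Qdef: "Q = mat_of_cols n qs" using b by (simp add: Q_def arnoldi_Q_def qs_def)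
  have Q: "Q \<in> carrier_mat n k" by (simp add: Qdef len carrier_matI)
  have Qi: "Q $$ (r, i) = qs ! i $ r" if "r < n" "i < k" for r i
    using that by (simp add: Qdef mat_of_cols_index len)
  have Qc: "col Q i = qs ! i" if "i < k" for i
    unfolding Qdef using that by (intro col_mat_of_cols qs) (auto simp: len)
  have H: "H \<in> carrier_mat k k" by (simp add: H_def arnoldi_H_def)
  have Hi: "H $$ (i, j) = (if i \<le> j then fst (arnoldi_step M b j) ! i
     else if i = Suc j then complex_of_real (vec_norm (snd (arnoldi_step M b j))) else 0)"
    if "i < k" "j < k" for i j
    using that by (simp add: H_def arnoldi_H_def arnoldi_h_step)
  define w where "w = snd (arnoldi_step M b (k - 1))"
  have onj: "orthonormal_list n (arnoldi_basis M b (Suc j))" if "j < k" for j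
    using that by (intro orthonormal_arnoldi_basis[OF M b] arnoldi_reaches_mono[OF reach]) auto
  note step = arnoldi_step_correct[OF M onj]
  have w: "w \<in> carrier_vec n" using step(1)[of "k - 1"] k by (simp add: w_def)
  have wq: "w \<bullet>c qs ! i = 0" if "i < k" for i
    using step(2)[of "k - 1" i] k that by (simp add: w_def qs_def)
  have QQ: "mat_adjoint Q * Q = 1\<^sub>m k"
  proof (rule eq_matI)
    fix i j assume "i < dim_row (1\<^sub>m k)" "j < dim_col (1\<^sub>m k)"
    thus "(mat_adjoint Q * Q) $$ (i, j) = 1\<^sub>m k $$ (i, j)"
      using Q on len by (subst mat_adjoint_mult_index) (auto simp: Qc orthonormal_list_def)
  qed (use Q in auto)
  have Qw: "mat_adjoint Q *\<^sub>v w = 0\<^sub>v k"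
  proof (rule eq_vecI)
    fix i assume i: "i < dim_vec (0\<^sub>v k)"
    have "(mat_adjoint Q *\<^sub>v w) $ i = (\<Sum>l<n. cnj (Q $$ (l, i)) * w $ l)"
      using i Q w by (subst mat_vec_index_sum) auto
    also have "\<dots> = w \<bullet>c qs ! i"
      using i qs[of i] by (simp add: cscalar_prod_sum Qi mult.commute)
    finally show "(mat_adjoint Q *\<^sub>v w) $ i = 0\<^sub>v k $ i" using wq i by simp
  qed (use Q in auto)
  have rel: "M * Q = Q * H + mat n k (\<lambda>(r, j). if j = k - 1 then w $ r else 0)" (is "_ = ?R")
  proof (rule eq_matI)
    fix r j assume "r < dim_row ?R" "j < dim_col ?R"
    hence r: "r < n" and j: "j < k" by auto
    define wj where "wj = snd (arnoldi_step M b j)"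
    define hs where "hs = fst (arnoldi_step M b j)"
    have qsj: "arnoldi_basis M b (Suc j) ! i = qs ! i" if "i \<le> j" for i
      unfolding qs_def using that j by (intro arnoldi_basis_nth_mono[symmetric]) auto
    have "(M * Q) $$ (r, j) = (M *\<^sub>v qs ! j) $ r"
      using M Q r j by (simp add: Qc)
    also have "\<dots> = wj $ r + (\<Sum>i\<le>j. hs ! i * qs ! i $ r)"
      using step(3)[OF j r] unfolding wj_def hs_def by (simp add: qsj)
    also have "\<dots> = (\<Sum>i<k. Q $$ (r, i) * H $$ (i, j)) + (if j = k - 1 then w $ r else 0)"
    proof (cases "j = k - 1")
      \<comment> \<open>In the last column every row index is at most \<open>j\<close>, so H has no
        subdiagonal entry there and the remainder stays as the extra term.\<close>
      case True
      hence "{..j} = {..<k}" using k by auto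
      moreover have "wj = w" by (simp add: wj_def w_def True)
      moreover have "i \<le> j" if "i < k" for i using that True by simp
      hence "(\<Sum>i<k. hs ! i * qs ! i $ r) = (\<Sum>i<k. Q $$ (r, i) * H $$ (i, j))"
        using r by (intro sum.cong) (simp_all add: Qi Hi[OF _ j] hs_def mult.commute)
      ultimately show ?thesis using True by simp
    next
      case False
      hence j': "Suc j < k" using j by simp
      \<comment> \<open>The rows split into those on and above the diagonal, the subdiagonal one,
        and zeros below. The subdiagonal term restores \<open>wj\<close>, being its norm times its
        normalisation.\<close>
      have split: "{..<k} = {..j} \<union> insert (Suc j) {Suc j<..<k}" using j' by auto
      have "(\<Sum>i<k. Q $$ (r, i) * H $$ (i, j)) =
        (\<Sum>i\<le>j. Q $$ (r, i) * H $$ (i, j)) + (Q $$ (r, Suc j) * H $$ (Suc j, j)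
        + (\<Sum>i\<in>{Suc j<..<k}. Q $$ (r, i) * H $$ (i, j)))"
        unfolding split by (subst sum.union_disjoint) auto
      also have "(\<Sum>i\<in>{Suc j<..<k}. Q $$ (r, i) * H $$ (i, j)) = 0"
        using j by (intro sum.neutral) (auto simp: Hi)
      also have "(\<Sum>i\<le>j. Q $$ (r, i) * H $$ (i, j)) = (\<Sum>i\<le>j. hs ! i * qs ! i $ r)"
        using j r by (intro sum.cong) (auto simp: Hi Qi hs_def)
      also have "Q $$ (r, Suc j) * H $$ (Suc j, j) = wj $ r"
      proof -
        have wjc: "wj \<in> carrier_vec n" unfolding wj_def by (rule step(1)[OF j])
        have "arnoldi_h M b (Suc j + 1) (Suc j) \<noteq> 0"
          using reach j' unfolding arnoldi_reaches_def by simp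
        hence nz: "vec_norm wj \<noteq> 0" by (simp add: arnoldi_h_step wj_def)
        have "qs ! Suc j = normalise wj"
          using arnoldi_basis_nth_mono[of "Suc j" "Suc (Suc j)" k M b] j'
          unfolding qs_def arnoldi_basis_Suc_step wj_def by (simp add: nth_append)
        thus ?thesis
          using nz wjc r j j' by (simp add: Qi Hi wj_def[symmetric] normalise_def)
      qed
      finally show ?thesis using False by simp
    qed
    also have "\<dots> = ?R $$ (r, j)"
      using Q H r j by (simp add: mat_mult_index_sum del: index_mult_mat(1))
    finally show "(M * Q) $$ (r, j) = ?R $$ (r, j)" .
  qed (use M Q in auto)
  have "qs ! 0 = normalise b"
    using arnoldi_basis_nth_mono[of 0 "Suc 0" k M b] k by (simp add: qs_def)
  hence "b = complex_of_real (vec_norm b) \<cdot>\<^sub>v col Q 0"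
    using vec_norm_eq_0[OF b(1)] b k by (simp add: Qc normalise_def smult_smult_assoc)
  with Q H QQ w Qw rel show thesis by (intro that) (auto simp: Hi)
qed

subsection \<open>Ritz values and the resolvent\<close>

lemma prod_list_map_upt: "prod_list (map f [0..<k]) = (\<Prod>l<k. f l :: 'a :: comm_monoid_mult)"
  using prod.distinct_set_conv_list[of "[0..<k]" f] by (simp add: atLeast0LessThan)

lemma diag_conj_index:
  assumes U: "unitary_mat n U" and ij: "i < n" "j < n"
  shows "(U * mat_diag n f * mat_adjoint U) $$ (i, j) = (\<Sum>l<n. U $$ (i, l) * f l * cnj (U $$ (j, l)))"
proof -
  note Uc = unitary_matD[OF U]
  have "(U * mat_diag n f * mat_adjoint U) $$ (i, j) = (\<Sum>l<n. (U * mat_diag n f) $$ (i, l) * mat_adjoint U $$ (l, j))"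
    using Uc(1) ij by (subst mat_mult_index_sum) auto
  also have "\<dots> = (\<Sum>l<n. U $$ (i, l) * f l * cnj (U $$ (j, l)))"
    unfolding mat_diag_mult_right[OF Uc(1)] using Uc(1) ij by (intro sum.cong) auto
  finally show ?thesis .
qed

text \<open>The corner entry of \<open>(H + tI)\<^sup>-\<^sup>1\<close> is, up to sign, a minor of \<open>H + tI\<close> divided by \<open>det (H + tI)\<close>;
  since \<open>H\<close> is upper Hessenberg, that minor is triangular and \<open>t\<close> occurs only above its diagonal.\<close>

lemma hessenberg_resolvent_corner:
  fixes \<theta> :: "nat \<Rightarrow> complex"
  assumes V: "unitary_mat k V" and H: "H = V * mat_diag k \<theta> * mat_adjoint V" and k: "k \<ge> 1"
    and hess: "\<And>i j. i < k \<Longrightarrow> j < k \<Longrightarrow> Suc j < i \<Longrightarrow> H $$ (i, j) = 0"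
    and nz: "\<And>l. l < k \<Longrightarrow> \<theta> l + t \<noteq> 0"
  shows "(\<Sum>l<k. V $$ (k - 1, l) * (1 / (\<theta> l + t)) * cnj (V $$ (0, l))) * (\<Prod>l<k. \<theta> l + t) =
    (- 1) ^ (k - 1) * (\<Prod>i<k - 1. H $$ (Suc i, i))"
proof -
  \<comment> \<open>\<open>B\<close> is H + t I and \<open>R\<close> its inverse, both written in
    the eigenbasis of H.\<close>
  define B where "B = V * mat_diag k (\<lambda>l. \<theta> l + t) * mat_adjoint V"
  define R where "R = V * mat_diag k (\<lambda>l. 1 / (\<theta> l + t)) * mat_adjoint V"
  note Vc = unitary_matD[OF V]
  have Bc: "B \<in> carrier_mat k k" and Rc: "R \<in> carrier_mat k k" using Vc(1) by (simp_all add: B_def R_def)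
  have B_index: "B $$ (i, j) = H $$ (i, j) + (if i = j then t else 0)" if ij: "i < k" "j < k" for i j
  proof -
    have "(\<Sum>l<k. V $$ (i, l) * cnj (V $$ (j, l))) = (V * mat_adjoint V) $$ (i, j)"
      using Vc(1) ij by (subst mat_mult_index_sum) auto
    also have "\<dots> = (if i = j then 1 else 0)" using ij Vc(3) by simp
    finally have "t * (\<Sum>l<k. V $$ (i, l) * cnj (V $$ (j, l))) = (if i = j then t else 0)" by simp
    thus ?thesis
      unfolding B_def H diag_conj_index[OF V ij]
      by (simp add: distrib_left distrib_right sum.distrib sum_distrib_left mult_ac)
  qed
  have "mat_diag k (\<lambda>i. (\<theta> i + t) * (1 / (\<theta> i + t))) = 1\<^sub>m k"
    by (rule eq_matI) (use nz in \<open>auto simp: mat_diag_def\<close>)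
  hence BR: "B * R = 1\<^sub>m k"
    unfolding B_def R_def diag_conj_mult[OF V] using Vc by simp
  have detB: "det B = (\<Prod>l<k. \<theta> l + t)"
  proof -
    let ?D = "mat_diag k (\<lambda>l. \<theta> l + t)"
    have D: "?D \<in> carrier_mat k k" by simp
    have "det V * det (mat_adjoint V) = 1"
      using det_mult[OF Vc(1) mat_adjoint_carrier[OF Vc(1)]] Vc(3) by simp
    moreover have "det B = det V * det ?D * det (mat_adjoint V)"
      unfolding B_def det_mult[OF mult_square_carrier[OF Vc(1) D] mat_adjoint_carrier[OF Vc(1)]]
        det_mult[OF Vc(1) D] ..
    moreover have "det ?D = (\<Prod>l<k. \<theta> l + t)"
    proof -
      have "upper_triangular ?D" by (auto simp: mat_diag_def)
      hence "det ?D = prod_list (diag_mat ?D)" by (rule det_upper_triangular[OF _ D])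
      also have "diag_mat ?D = map (\<lambda>l. \<theta> l + t) [0..<k]"
        by (auto simp: diag_mat_def mat_diag_def)
      also have "prod_list \<dots> = (\<Prod>l<k. \<theta> l + t)"
        by (rule prod_list_map_upt)
      finally show ?thesis .
    qed
    ultimately show ?thesis by (simp add: mult_ac)
  qed
  note adj = adj_mat[OF Bc]
  have "adj_mat B = adj_mat B * (B * R)" using BR adj(1) by (simp add: right_mult_one_mat[of _ k k])
  also have "\<dots> = det B \<cdot>\<^sub>m R"
    using assoc_mult_mat[OF adj(1) Bc Rc]
    unfolding adj(3) mult_smult_assoc_mat[OF one_carrier_mat Rc] left_mult_one_mat[OF Rc] by (rule sym)
  finally have "adj_mat B $$ (k - 1, 0) = det B * R $$ (k - 1, 0)" using Rc k by simp
  moreover have "adj_mat B $$ (k - 1, 0) = cofactor B 0 (k - 1)"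
    using Bc k by (simp add: adj_mat_def)
  \<comment> \<open>The adjugate transposes, so the entry in the last row and first column comes
    from deleting the first row and the last column. This moves the subdiagonal of H onto the
    diagonal of \<open>C\<close> and the shift t onto its superdiagonal.\<close>
  moreover have "cofactor B 0 (k - 1) = (- 1) ^ (k - 1) * (\<Prod>i<k - 1. H $$ (Suc i, i))"
  proof -
    define C where "C = mat_delete B 0 (k - 1)"
    have Cc: "C \<in> carrier_mat (k - 1) (k - 1)" unfolding C_def by (rule mat_delete_carrier[OF Bc])
    have Ci: "C $$ (i, j) = H $$ (Suc i, j) + (if Suc i = j then t else 0)" if "i < k - 1" "j < k - 1" for i j
      using that Bc B_index[of "Suc i" j] by (simp add: C_def mat_delete_def)
    have "upper_triangular C" using Cc Ci hess by auto
    hence "det C = prod_list (diag_mat C)" by (rule det_upper_triangular[OF _ Cc])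
    also have "diag_mat C = map (\<lambda>i. H $$ (Suc i, i)) [0..<k - 1]"
      using Cc Ci by (auto simp: diag_mat_def)
    also have "prod_list \<dots> = (\<Prod>i<k - 1. H $$ (Suc i, i))"
      by (rule prod_list_map_upt)
    finally show ?thesis by (simp add: cofactor_def C_def)
  qed
  moreover have "R $$ (k - 1, 0) = (\<Sum>l<k. V $$ (k - 1, l) * (1 / (\<theta> l + t)) * cnj (V $$ (0, l)))"
    unfolding R_def using k by (intro diag_conj_index[OF V]) auto
  ultimately show ?thesis by (simp add: detB mult.commute)
qed

text \<open>P = G G^* is an orthogonal projection. Its diagonal entry p satisfies p = (P P)_ii =
  sum_m |P_im|^2 >= p^2, hence p <= 1.\<close>

lemma bessel_rows:
  fixes G :: "complex mat"
  assumes G: "G \<in> carrier_mat n k" and GG: "mat_adjoint G * G = 1\<^sub>m k" and i: "i < n"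
  shows "(\<Sum>l<k. (cmod (G $$ (i, l)))\<^sup>2) \<le> 1"
proof -
  define P where "P = G * mat_adjoint G"
  define p where "p = (\<Sum>l<k. (cmod (G $$ (i, l)))\<^sup>2)"
  have Ga: "mat_adjoint G \<in> carrier_mat k n" using G by simp
  have P: "P \<in> carrier_mat n n" unfolding P_def by (rule mult_carrier_mat[OF G Ga])
  have Pij: "P $$ (r, s) = (\<Sum>l<k. G $$ (r, l) * cnj (G $$ (s, l)))" if "r < n" "s < n" for r s
    unfolding P_def using G that by (subst mat_mult_index_sum) auto
  have "P * P = G * (mat_adjoint G * (G * mat_adjoint G))"
    unfolding P_def by (rule assoc_mult_mat[OF G Ga mult_carrier_mat[OF G Ga]])
  also have "mat_adjoint G * (G * mat_adjoint G) = mat_adjoint G"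
    using assoc_mult_mat[OF Ga G Ga] unfolding GG left_mult_one_mat[OF Ga] by (rule sym)
  finally have PP: "P * P = P" by (simp add: P_def)
  have Pii: "P $$ (i, i) = of_real p"
    unfolding Pij[OF i i] p_def by (simp add: complex_norm_square del: of_real_power)
  have p: "p \<ge> 0" by (simp add: p_def sum_nonneg)
  have "of_real p = (P * P) $$ (i, i)" by (simp add: PP Pii)
  also have "\<dots> = (\<Sum>m<n. P $$ (i, m) * P $$ (m, i))"
    using P i by (subst mat_mult_index_sum) auto
  also have "\<dots> = (\<Sum>m<n. of_real ((cmod (P $$ (i, m)))\<^sup>2))"
    unfolding complex_norm_square using i
    by (intro sum.cong arg_cong2[of _ _ _ _ "(*)"]) (auto simp: Pij mult.commute)
  finally have "p = (\<Sum>m<n. (cmod (P $$ (i, m)))\<^sup>2)"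
    by (simp only: of_real_sum[symmetric] of_real_eq_iff)
  also have "\<dots> \<ge> (cmod (P $$ (i, i)))\<^sup>2"
    using i by (intro member_le_sum) auto
  finally have "p * p \<le> p * 1" using p by (simp add: Pii power2_eq_square)
  thus ?thesis using p unfolding p_def[symmetric] by (cases "p = 0") auto
qed

text \<open>A bathtub argument: after subtracting the threshold c = \<open>\<mu> (k - 1)\<close> the
  coefficients are nonnegative before index k and nonpositive from k on, so weight 1 on the first k
  indices and 0 elsewhere is optimal. Both weightings have total k, so the subtracted constants
  cancel.\<close>

lemma weighted_sum_le_top_sum:
  fixes \<mu> w :: "nat \<Rightarrow> real"
  assumes mono: "\<And>i j. i \<le> j \<Longrightarrow> j < n \<Longrightarrow> \<mu> j \<le> \<mu> i"
    and w: "\<And>i. i < n \<Longrightarrow> 0 \<le> w i" "\<And>i. i < n \<Longrightarrow> w i \<le> 1"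
    and sum: "(\<Sum>i<n. w i) = real k" and k: "1 \<le> k"
  shows "k \<le> n" "(\<Sum>i<n. \<mu> i * w i) \<le> (\<Sum>i<k. \<mu> i)"
proof -
  have "(\<Sum>i<n. w i) \<le> (\<Sum>i<n. 1)" by (rule sum_mono) (use w in auto)
  thus kn: "k \<le> n" using sum by simp
  define c where "c = \<mu> (k - 1)"
  have "(\<Sum>i<n. (\<mu> i - c) * w i) \<le> (\<Sum>i<n. if i < k then \<mu> i - c else 0)"
  proof (rule sum_mono)
    fix i assume "i \<in> {..<n}"
    hence i: "i < n" by simp
    show "(\<mu> i - c) * w i \<le> (if i < k then \<mu> i - c else 0)"
    proof (cases "i < k")
      case True
      hence "\<mu> i - c \<ge> 0" using mono[of i "k - 1"] kn k by (auto simp: c_def)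
      thus ?thesis using True w(2)[OF i] mult_left_mono[of "w i" 1 "\<mu> i - c"] by simp
    next
      case False
      hence "\<mu> i - c \<le> 0" using mono[of "k - 1" i] i k by (auto simp: c_def)
      thus ?thesis using False w(1)[OF i] by (simp add: mult_nonpos_nonneg)
    qed
  qed
  also have "\<dots> = (\<Sum>i\<in>{..<n} \<inter> {i. i < k}. \<mu> i - c)"
    by (subst sum.inter_restrict) (auto intro: sum.cong)
  also have "{..<n} \<inter> {i. i < k} = {..<k}" using kn by auto
  finally show "(\<Sum>i<n. \<mu> i * w i) \<le> (\<Sum>i<k. \<mu> i)"
    by (simp add: left_diff_distrib sum_subtractf sum flip: sum_distrib_left)
qed

section \<open>Coordinates in the eigenbases of M and H\<close>

lemma vec_norm_adjoint_unitary:
  assumes U: "unitary_mat n U" and x: "x \<in> carrier_vec n"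
  shows "vec_norm (mat_adjoint U *\<^sub>v x) = vec_norm x"
proof -
  note Uc = unitary_matD[OF U] and Ua = mat_adjoint_carrier[OF unitary_matD(1)[OF U]]
  have y: "mat_adjoint U *\<^sub>v x \<in> carrier_vec n" by (rule mult_mat_vec_carrier[OF Ua x])
  have "U *\<^sub>v (mat_adjoint U *\<^sub>v x) = x"
    using assoc_mult_mat_vec[OF Uc(1) Ua x] Uc(3) x by simp
  hence "(mat_adjoint U *\<^sub>v x) \<bullet>c (mat_adjoint U *\<^sub>v x) = x \<bullet>c x"
    using mult_mat_vec_cscalar[OF Ua x y] by simp
  hence "(vec_norm (mat_adjoint U *\<^sub>v x))\<^sup>2 = (vec_norm x)\<^sup>2"
    unfolding vec_norm_square[symmetric] of_real_eq_iff .
  thus ?thesis by (simp add: power2_eq_iff_nonneg)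
qed

lemma vec_norm_mono_scaled:
  assumes "dim_vec v = dim_vec w" "c \<ge> 0" "\<And>i. i < dim_vec w \<Longrightarrow> cmod (v $ i) \<le> c * cmod (w $ i)"
  shows "vec_norm v \<le> c * vec_norm w"
  unfolding vec_norm_def L2_set_right_distrib[OF assms(2)] assms(1)
  by (rule L2_set_mono) (use assms(3) in auto)

lemma isometry_mult:
  fixes A B :: "complex mat"
  assumes A: "A \<in> carrier_mat m n" "mat_adjoint A * A = 1\<^sub>m n"
    and B: "B \<in> carrier_mat n k" "mat_adjoint B * B = 1\<^sub>m k"
  shows "A * B \<in> carrier_mat m k" "mat_adjoint (A * B) * (A * B) = 1\<^sub>m k"
proof -
  show "A * B \<in> carrier_mat m k" by (rule mult_carrier_mat[OF A(1) B(1)])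
  have Aa: "mat_adjoint A \<in> carrier_mat n m" and Ba: "mat_adjoint B \<in> carrier_mat k n"
    using A(1) B(1) by simp_all
  have "mat_adjoint (A * B) = mat_adjoint B * mat_adjoint A"
    using A(1) B(1) by (intro mat_adjoint_mult) simp
  hence "mat_adjoint (A * B) * (A * B) = mat_adjoint B * (mat_adjoint A * (A * B))"
    using assoc_mult_mat[OF Ba Aa mult_carrier_mat[OF A(1) B(1)]] by simp
  also have "mat_adjoint A * (A * B) = B"
    using assoc_mult_mat[OF Aa A(1) B(1)] unfolding A(2) left_mult_one_mat[OF B(1)] by (rule sym)
  finally show "mat_adjoint (A * B) * (A * B) = 1\<^sub>m k" using B(2) by simp
qed

lemma diag_conj_coordinates:
  assumes U: "unitary_mat n U" and x: "x \<in> carrier_vec n" and i: "i < n"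
  shows "(mat_adjoint U *\<^sub>v ((U * mat_diag n f * mat_adjoint U) *\<^sub>v x)) $ i = f i * (mat_adjoint U *\<^sub>v x) $ i"
proof -
  note Uc = unitary_matD[OF U] and Ua = mat_adjoint_carrier[OF unitary_matD(1)[OF U]]
  define y where "y = mat_adjoint U *\<^sub>v x"
  have y: "y \<in> carrier_vec n" unfolding y_def by (rule mult_mat_vec_carrier[OF Ua x])
  have D: "mat_diag n f \<in> carrier_mat n n" by simp
  have Dy: "mat_diag n f *\<^sub>v y \<in> carrier_vec n" by (rule mult_mat_vec_carrier[OF D y])
  have "(U * mat_diag n f * mat_adjoint U) *\<^sub>v x = U *\<^sub>v (mat_diag n f *\<^sub>v y)"
    unfolding assoc_mult_mat_vec[OF mult_square_carrier[OF Uc(1) D] Ua x]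
      assoc_mult_mat_vec[OF Uc(1) D y[unfolded y_def]] y_def ..
  hence "mat_adjoint U *\<^sub>v ((U * mat_diag n f * mat_adjoint U) *\<^sub>v x) = mat_diag n f *\<^sub>v y"
    using assoc_mult_mat_vec[OF Ua Uc(1) Dy] Dy unfolding Uc(2) by simp
  thus ?thesis using mat_diag_mult_vec_index[OF y i] by (simp add: y_def)
qed

text \<open>The choices f = 1/theta, f = sqrt theta and f = 1 give the coordinates of the FOM
  iterate, of the Arnoldi approximation and of b itself, all with the same weights.\<close>

lemma projected_coordinates:
  assumes U: "unitary_mat n U" and V: "unitary_mat k V" and Q: "Q \<in> carrier_mat n k"
    and i: "i < n" and k: "k \<ge> 1"
  shows "(mat_adjoint U *\<^sub>v (Q *\<^sub>v ((V * mat_diag k f * mat_adjoint V) *\<^sub>v (c \<cdot>\<^sub>v unit_vec k 0)))) $ i =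
    (\<Sum>l<k. (mat_adjoint U * Q * V) $$ (i, l) * (f l * (c * cnj (V $$ (0, l)))))"
proof -
  note Vc = unitary_matD[OF V] and Va = mat_adjoint_carrier[OF unitary_matD(1)[OF V]]
  note Ua = mat_adjoint_carrier[OF unitary_matD(1)[OF U]]
  have D: "mat_diag k f \<in> carrier_mat k k" by simp
  define x :: "complex vec" where "x = c \<cdot>\<^sub>v unit_vec k 0"
  define y where "y = mat_adjoint V *\<^sub>v x"
  define z where "z = mat_diag k f *\<^sub>v y"
  have x: "x \<in> carrier_vec k" by (simp add: x_def)
  have y: "y \<in> carrier_vec k" unfolding y_def by (rule mult_mat_vec_carrier[OF Va x])
  have z: "z \<in> carrier_vec k" unfolding z_def by (rule mult_mat_vec_carrier[OF D y])
  have UQ: "mat_adjoint U * Q \<in> carrier_mat n k" by (rule mult_carrier_mat[OF Ua Q])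
  have yl: "y $ l = c * cnj (V $$ (0, l))" if "l < k" for l
  proof -
    have "y $ l = (\<Sum>j<k. cnj (V $$ (j, l)) * x $ j)"
      unfolding y_def using that Vc(1) x by (subst mat_vec_index_sum) auto
    also have "\<dots> = (\<Sum>j<k. if j = 0 then c * cnj (V $$ (0, l)) else 0)"
      by (intro sum.cong) (auto simp: x_def)
    finally show ?thesis using k by simp
  qed
  have "(V * mat_diag k f * mat_adjoint V) *\<^sub>v x = V *\<^sub>v z"
    unfolding assoc_mult_mat_vec[OF mult_square_carrier[OF Vc(1) D] Va x]
      assoc_mult_mat_vec[OF Vc(1) D y[unfolded y_def]] y_def z_def ..
  moreover have "mat_adjoint U *\<^sub>v (Q *\<^sub>v (V *\<^sub>v z)) = (mat_adjoint U * Q * V) *\<^sub>v z"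
    unfolding assoc_mult_mat_vec[OF UQ Vc(1) z]
      assoc_mult_mat_vec[OF Ua Q mult_mat_vec_carrier[OF Vc(1) z]] ..
  ultimately have "mat_adjoint U *\<^sub>v (Q *\<^sub>v ((V * mat_diag k f * mat_adjoint V) *\<^sub>v x)) = (mat_adjoint U * Q * V) *\<^sub>v z"
    by simp
  also have "\<dots> $ i = (\<Sum>l<k. (mat_adjoint U * Q * V) $$ (i, l) * z $ l)"
    using i z Vc(1) UQ by (subst mat_vec_index_sum) auto
  also have "\<dots> = (\<Sum>l<k. (mat_adjoint U * Q * V) $$ (i, l) * (f l * (c * cnj (V $$ (0, l)))))"
    unfolding z_def by (intro sum.cong) (auto simp: mat_diag_mult_vec_index[OF y] yl simp del: index_mult_mat index_mult_mat_vec)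
  finally show ?thesis unfolding x_def .
qed

text \<open>The case f = 1. It expresses that b lies in the range of Q, and it supplies the identity
  by which the constant terms cancel under the integral.\<close>

lemma first_column_coordinates:
  assumes U: "unitary_mat n U" and V: "unitary_mat k V" and Q: "Q \<in> carrier_mat n k"
    and i: "i < n" and k: "k \<ge> 1"
  shows "(mat_adjoint U *\<^sub>v (c \<cdot>\<^sub>v col Q 0)) $ i =
    (\<Sum>l<k. (mat_adjoint U * Q * V) $$ (i, l) * (c * cnj (V $$ (0, l))))"
proof -
  have "V * mat_diag k (\<lambda>_. 1) * mat_adjoint V = 1\<^sub>m k"
    using unitary_matD[OF V] by simp
  moreover have "Q *\<^sub>v (c \<cdot>\<^sub>v unit_vec k 0) = c \<cdot>\<^sub>v col Q 0"
    using Q k mult_mat_vec[OF Q unit_vec_carrier] col_mult2[OF Q one_carrier_mat, of 0] by simp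
  ultimately show ?thesis
    using projected_coordinates[OF assms, of "\<lambda>_. 1" c] by simp
qed

text \<open>The Arnoldi relation is read between U^* and V, which diagonalises both M and H; the
  extra column becomes an outer product with the last row of V. The equation is not divided by \<mu>
  i - \<theta> l, which may vanish.\<close>

lemma lanczos_coordinates:
  fixes \<mu> \<theta> :: "nat \<Rightarrow> complex"
  assumes U: "unitary_mat n U" and M: "M = U * mat_diag n \<mu> * mat_adjoint U"
    and V: "unitary_mat k V" and H: "H = V * mat_diag k \<theta> * mat_adjoint V"
    and Q: "Q \<in> carrier_mat n k" and w: "w \<in> carrier_vec n" and k: "k \<ge> 1"
    and rel: "M * Q = Q * H + mat n k (\<lambda>(r, j). if j = k - 1 then w $ r else 0)"
    and i: "i < n" and l: "l < k"
  shows "\<mu> i * (mat_adjoint U * Q * V) $$ (i, l) =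
    (mat_adjoint U * Q * V) $$ (i, l) * \<theta> l + (mat_adjoint U *\<^sub>v w) $ i * V $$ (k - 1, l)"
proof -
  note Uc = unitary_matD[OF U] and Ua = mat_adjoint_carrier[OF unitary_matD(1)[OF U]]
  note Vc = unitary_matD[OF V] and Va = mat_adjoint_carrier[OF unitary_matD(1)[OF V]]
  define W where "W = mat n k (\<lambda>(r, j). if j = k - 1 then w $ r else 0)"
  define D where "D = mat_diag n \<mu>"
  define T where "T = mat_diag k \<theta>"
  have D: "D \<in> carrier_mat n n" and T: "T \<in> carrier_mat k k" and W: "W \<in> carrier_mat n k"
    by (simp_all add: D_def T_def W_def)
  have Mc: "M \<in> carrier_mat n n" and Hc: "H \<in> carrier_mat k k" using Uc(1) Vc(1) by (simp_all add: M H)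
  have UQ: "mat_adjoint U * Q \<in> carrier_mat n k" by (rule mult_carrier_mat[OF Ua Q])
  define G where "G = mat_adjoint U * Q * V"
  have G: "G \<in> carrier_mat n k" unfolding G_def by (rule mult_carrier_mat[OF UQ Vc(1)])
  have UM: "mat_adjoint U * M = D * mat_adjoint U"
  proof -
    have "mat_adjoint U * M = mat_adjoint U * (U * (D * mat_adjoint U))"
      unfolding M D_def[symmetric] assoc_mult_mat[OF Uc(1) D Ua] ..
    also have "\<dots> = (mat_adjoint U * U) * (D * mat_adjoint U)"
      by (rule assoc_mult_mat[OF Ua Uc(1) mult_carrier_mat[OF D Ua], symmetric])
    finally show ?thesis
      unfolding Uc(2) left_mult_one_mat[OF mult_carrier_mat[OF D Ua]] .
  qed
  have HV: "H * V = V * T"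
  proof -
    have "H * V = V * T * (mat_adjoint V * V)"
      unfolding H T_def[symmetric] by (rule assoc_mult_mat[OF mult_carrier_mat[OF Vc(1) T] Va Vc(1)])
    thus ?thesis unfolding Vc(2) right_mult_one_mat[OF mult_carrier_mat[OF Vc(1) T]] .
  qed
  have "D * G = (D * mat_adjoint U) * Q * V"
    unfolding G_def assoc_mult_mat[OF D UQ Vc(1), symmetric] assoc_mult_mat[OF D Ua Q] ..
  also have "\<dots> = mat_adjoint U * (M * Q) * V"
    unfolding UM[symmetric] assoc_mult_mat[OF Ua Mc Q] ..
  also have "mat_adjoint U * (M * Q) = mat_adjoint U * (Q * H) + mat_adjoint U * W"
    unfolding rel W_def[symmetric] by (rule mult_add_distrib_mat[OF Ua mult_carrier_mat[OF Q Hc] W])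
  also have "(mat_adjoint U * (Q * H) + mat_adjoint U * W) * V =
      mat_adjoint U * (Q * H) * V + mat_adjoint U * W * V"
    by (rule add_mult_distrib_mat[OF mult_carrier_mat[OF Ua mult_carrier_mat[OF Q Hc]] mult_carrier_mat[OF Ua W] Vc(1)])
  also have "mat_adjoint U * (Q * H) * V = G * T"
    unfolding G_def assoc_mult_mat[OF Ua Q Hc, symmetric] assoc_mult_mat[OF UQ Hc Vc(1)] HV
      assoc_mult_mat[OF UQ Vc(1) T] ..
  finally have "(D * G) $$ (i, l) = (G * T + mat_adjoint U * W * V) $$ (i, l)" by simp
  moreover have "(D * G) $$ (i, l) = \<mu> i * G $$ (i, l)"
    unfolding D_def mat_diag_mult_left[OF G] using i l by simp
  moreover have "(G * T) $$ (i, l) = G $$ (i, l) * \<theta> l"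
    unfolding T_def mat_diag_mult_right[OF G] using i l by simp
  moreover have "(mat_adjoint U * W * V) $$ (i, l) = (mat_adjoint U *\<^sub>v w) $ i * V $$ (k - 1, l)"
  proof -
    have UW: "(mat_adjoint U * W) $$ (i, j) = (if j = k - 1 then (mat_adjoint U *\<^sub>v w) $ i else 0)"
      if "j < k" for j
    proof -
      have "(mat_adjoint U * W) $$ (i, j) = (\<Sum>r<n. mat_adjoint U $$ (i, r) * W $$ (r, j))"
        using Uc(1) W i that by (subst mat_mult_index_sum) auto
      moreover have "(mat_adjoint U *\<^sub>v w) $ i = (\<Sum>r<n. mat_adjoint U $$ (i, r) * w $ r)"
        using Uc(1) w i by (subst mat_vec_index_sum) auto
      ultimately show ?thesis using that by (simp add: W_def)
    qed
    have "(mat_adjoint U * W * V) $$ (i, l) = (\<Sum>j<k. (mat_adjoint U * W) $$ (i, j) * V $$ (j, l))"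
      using Uc(1) Vc(1) W i l by (subst mat_mult_index_sum) auto
    also have "\<dots> = (\<Sum>j<k. if j = k - 1 then (mat_adjoint U *\<^sub>v w) $ i * V $$ (k - 1, l) else 0)"
      by (intro sum.cong) (auto simp: UW simp del: index_mult_mat)
    finally show ?thesis using k by simp
  qed
  moreover have "(G * T + mat_adjoint U * W * V) $$ (i, l) = (G * T) $$ (i, l) + (mat_adjoint U * W * V) $$ (i, l)"
    using Uc(1) Vc(1) W G T i l by (intro index_add_mat) auto
  ultimately show ?thesis by (simp only: G_def)
qed

text \<open>The Ritz value is the Rayleigh quotient of M at the Ritz vector Q v_l, whose coordinates
  in the eigenbasis of M form column l of U^* Q V.\<close>

lemma ritz_value_eq_weighted_sum:
  fixes \<mu> \<theta> :: "nat \<Rightarrow> complex"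
  assumes U: "unitary_mat n U" and M: "M = U * mat_diag n \<mu> * mat_adjoint U"
    and V: "unitary_mat k V" and H: "mat_adjoint Q * M * Q = V * mat_diag k \<theta> * mat_adjoint V"
    and Q: "Q \<in> carrier_mat n k" and l: "l < k"
  shows "\<theta> l = (\<Sum>i<n. \<mu> i * of_real ((cmod ((mat_adjoint U * Q * V) $$ (i, l)))\<^sup>2))"
proof -
  note Uc = unitary_matD[OF U] and Ua = mat_adjoint_carrier[OF unitary_matD(1)[OF U]]
  note Vc = unitary_matD[OF V] and Va = mat_adjoint_carrier[OF unitary_matD(1)[OF V]]
  have Qa: "mat_adjoint Q \<in> carrier_mat k n" using Q by simp
  define G where "G = mat_adjoint U * Q * V"
  define v where "v = col V l"
  define x where "x = Q *\<^sub>v v"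
  define g where "g = mat_adjoint U *\<^sub>v x"
  have v: "v \<in> carrier_vec k" unfolding v_def by (rule col_carrier_vec[OF l Vc(1)])
  have x: "x \<in> carrier_vec n" unfolding x_def by (rule mult_mat_vec_carrier[OF Q v])
  have g: "g \<in> carrier_vec n" unfolding g_def by (rule mult_mat_vec_carrier[OF Ua x])
  have Mc: "M \<in> carrier_mat n n" using Uc(1) by (simp add: M)
  have UQ: "mat_adjoint U * Q \<in> carrier_mat n k" by (rule mult_carrier_mat[OF Ua Q])
  have g_index: "g $ i = G $$ (i, l)" if "i < n" for i
  proof -
    have "col G l = (mat_adjoint U * Q) *\<^sub>v v"
      unfolding G_def v_def by (rule col_mult2[OF UQ Vc(1) l])
    also have "\<dots> = g" unfolding g_def x_def by (rule assoc_mult_mat_vec[OF Ua Q v])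
    finally have "col G l = g" .
    thus ?thesis using that l UQ Vc(1) by (auto simp: G_def)
  qed
  have "(mat_adjoint Q * M * Q) *\<^sub>v v = mat_adjoint Q *\<^sub>v (M *\<^sub>v x)"
    unfolding x_def assoc_mult_mat_vec[OF mult_carrier_mat[OF Qa Mc] Q v]
      assoc_mult_mat_vec[OF Qa Mc mult_mat_vec_carrier[OF Q v]] ..
  moreover have "(mat_adjoint Q * M * Q) *\<^sub>v v = \<theta> l \<cdot>\<^sub>v v"
    unfolding H v_def by (rule diag_conj_column[OF V l])
  ultimately have eq: "mat_adjoint Q *\<^sub>v (M *\<^sub>v x) = \<theta> l \<cdot>\<^sub>v v" by simp
  have "(mat_adjoint Q *\<^sub>v (M *\<^sub>v x)) \<bullet>c v = \<theta> l * (v \<bullet>c v)" unfolding eq using v by simp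
  hence "\<theta> l = (mat_adjoint Q *\<^sub>v (M *\<^sub>v x)) \<bullet>c v"
    using unitary_column_self[OF V l] by (simp add: v_def)
  also have "\<dots> = (M *\<^sub>v x) \<bullet>c x"
    using mult_mat_vec_cscalar[OF Qa mult_mat_vec_carrier[OF Mc x] v] by (simp add: x_def)
  also have "\<dots> = (mat_adjoint U *\<^sub>v (M *\<^sub>v x)) \<bullet>c g"
  proof -
    have "U *\<^sub>v g = x"
      unfolding g_def assoc_mult_mat_vec[OF Uc(1) Ua x, symmetric] Uc(3) by (rule one_mult_mat_vec[OF x])
    thus ?thesis using mult_mat_vec_cscalar[OF Ua mult_mat_vec_carrier[OF Mc x] g] by simp
  qed
  also have "\<dots> = (\<Sum>i<n. \<mu> i * g $ i * cnj (g $ i))"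
    unfolding cscalar_prod_sum using g Uc(1) diag_conj_coordinates[OF U x, of _ \<mu>]
    by (intro sum.cong) (auto simp: M g_def)
  finally show ?thesis
    unfolding G_def[symmetric] by (simp add: g_index complex_norm_square mult.assoc del: of_real_power)
qed

text \<open>Multiplying the Arnoldi relation by Q^* kills the remainder column. Through this
  identity H is seen to be Hermitian, although it is defined as an upper Hessenberg array of
  coefficients.\<close>

lemma compression_eq:
  fixes M Q H :: "complex mat"
  assumes M: "M \<in> carrier_mat n n" and Q: "Q \<in> carrier_mat n k" and H: "H \<in> carrier_mat k k"
    and QQ: "mat_adjoint Q * Q = 1\<^sub>m k"
    and w: "w \<in> carrier_vec n" "mat_adjoint Q *\<^sub>v w = 0\<^sub>v k"
    and rel: "M * Q = Q * H + mat n k (\<lambda>(r, j). if j = k - 1 then w $ r else 0)"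
  shows "mat_adjoint Q * M * Q = H"
proof -
  define W where "W = mat n k (\<lambda>(r, j). if j = k - 1 then w $ r else 0)"
  have Qa: "mat_adjoint Q \<in> carrier_mat k n" and W: "W \<in> carrier_mat n k" using Q by (simp_all add: W_def)
  have QW: "mat_adjoint Q * W = 0\<^sub>m k k"
  proof (rule eq_matI)
    fix i j assume "i < dim_row (0\<^sub>m k k)" "j < dim_col (0\<^sub>m k k)"
    hence ij: "i < k" "j < k" by auto
    have "(mat_adjoint Q * W) $$ (i, j) = (\<Sum>r<n. mat_adjoint Q $$ (i, r) * W $$ (r, j))"
      using Q W ij by (subst mat_mult_index_sum) auto
    moreover have "(mat_adjoint Q *\<^sub>v w) $ i = (\<Sum>r<n. mat_adjoint Q $$ (i, r) * w $ r)"
      using Q w ij by (subst mat_vec_index_sum) auto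
    ultimately show "(mat_adjoint Q * W) $$ (i, j) = 0\<^sub>m k k $$ (i, j)"
      using ij w(2) by (cases "j = k - 1") (simp_all add: W_def)
  qed (use Q W in auto)
  have "mat_adjoint Q * M * Q = mat_adjoint Q * (Q * H) + mat_adjoint Q * W"
    unfolding assoc_mult_mat[OF Qa M Q] rel W_def[symmetric]
    by (rule mult_add_distrib_mat[OF Qa mult_carrier_mat[OF Q H] W])
  also have "mat_adjoint Q * (Q * H) = H"
    unfolding assoc_mult_mat[OF Qa Q H, symmetric] QQ by (rule left_mult_one_mat[OF H])
  finally show ?thesis using QW H by simp
qed

lemma hermitian_pos_def_compression:
  assumes M: "hermitian_pos_def n M" and Q: "Q \<in> carrier_mat n k" and QQ: "mat_adjoint Q * Q = 1\<^sub>m k"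
  shows "hermitian_pos_def k (mat_adjoint Q * M * Q)"
  unfolding hermitian_pos_def_def
proof (intro conjI ballI impI)
  have Mc: "M \<in> carrier_mat n n" and Mh: "mat_adjoint M = M" using M by (auto simp: hermitian_pos_def_def)
  have Qa: "mat_adjoint Q \<in> carrier_mat k n" using Q by simp
  note QM = mult_carrier_mat[OF Qa Mc] and MQ = mult_carrier_mat[OF Mc Q]
  show "mat_adjoint Q * M * Q \<in> carrier_mat k k" by (rule mult_carrier_mat[OF QM Q])
  have "mat_adjoint (mat_adjoint Q * (M * Q)) = mat_adjoint (M * Q) * mat_adjoint (mat_adjoint Q)"
    using Q Mc by (intro mat_adjoint_mult) auto
  also have "mat_adjoint (M * Q) = mat_adjoint Q * mat_adjoint M"
    using Q Mc by (intro mat_adjoint_mult) auto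
  finally show "mat_adjoint (mat_adjoint Q * M * Q) = mat_adjoint Q * M * Q"
    by (simp add: Mh assoc_mult_mat[OF Qa Mc Q])
  fix x :: "complex vec" assume x: "x \<in> carrier_vec k" "x \<noteq> 0\<^sub>v k"
  define y where "y = Q *\<^sub>v x"
  have y: "y \<in> carrier_vec n" unfolding y_def by (rule mult_mat_vec_carrier[OF Q x(1)])
  have "mat_adjoint Q *\<^sub>v y = x"
    unfolding y_def assoc_mult_mat_vec[OF Qa Q x(1), symmetric] QQ by (rule one_mult_mat_vec[OF x(1)])
  moreover have "mat_adjoint Q *\<^sub>v 0\<^sub>v n = 0\<^sub>v k" using Q by (intro eq_vecI) auto
  ultimately have "y \<noteq> 0\<^sub>v n" using x by auto
  hence "0 < Re ((M *\<^sub>v y) \<bullet>c y)" using M y by (simp add: hermitian_pos_def_def)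
  also have "(M *\<^sub>v y) \<bullet>c y = (mat_adjoint Q *\<^sub>v (M *\<^sub>v y)) \<bullet>c x"
    using mult_mat_vec_cscalar[OF Qa mult_mat_vec_carrier[OF Mc y] x(1)] by (simp add: y_def)
  also have "mat_adjoint Q *\<^sub>v (M *\<^sub>v y) = (mat_adjoint Q * M * Q) *\<^sub>v x"
    unfolding y_def assoc_mult_mat_vec[OF QM Q x(1)] assoc_mult_mat_vec[OF Qa Mc mult_mat_vec_carrier[OF Q x(1)]] ..
  finally show "0 < Re ((mat_adjoint Q * M * Q *\<^sub>v x) \<bullet>c x)" .
qed

text \<open>Pure algebra behind the factorisation of the shifted error. By \<open>rel\<close>,
  multiplying 1/(a + s) - 1/(theta_l + s) by g_l leaves only \<omega> and the last row
  \<open>\<nu>\<close>, so the error at shift s is -\<omega> c / (a + s) times the corner entry of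
  the resolvent. That entry is \<open>K\<close> over the product of the theta_l + s, with the same
  \<open>K\<close> for s = 0 and s = t; hence \<omega>, c and \<open>K\<close> are common to both
  errors.\<close>

lemma shifted_combination:
  fixes g d \<theta> \<nu> :: "nat \<Rightarrow> complex" and a t c \<omega> K :: complex
  assumes rel: "\<And>l. l < k \<Longrightarrow> a * g l = g l * \<theta> l + \<omega> * \<nu> l"
    and K0: "(\<Sum>l<k. \<nu> l * (1 / \<theta> l) * d l) * (\<Prod>l<k. \<theta> l) = K"
    and Kt: "(\<Sum>l<k. \<nu> l * (1 / (\<theta> l + t)) * d l) * (\<Prod>l<k. \<theta> l + t) = K"
    and nz: "a \<noteq> 0" "a + t \<noteq> 0" "\<And>l. l < k \<Longrightarrow> \<theta> l \<noteq> 0" "\<And>l. l < k \<Longrightarrow> \<theta> l + t \<noteq> 0"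
  shows "(\<Sum>l<k. g l * (c * d l)) / (a + t) - (\<Sum>l<k. g l * (c * d l) / (\<theta> l + t)) =
    ((\<Sum>l<k. g l * (c * d l)) / a - (\<Sum>l<k. g l * (c * d l) / \<theta> l)) *
    (a / (a + t) * (\<Prod>l<k. \<theta> l / (\<theta> l + t)))"
proof -
  have err: "(\<Sum>l<k. g l * (c * d l)) / (a + s) - (\<Sum>l<k. g l * (c * d l) / (\<theta> l + s)) =
      - \<omega> * c / (a + s) * (\<Sum>l<k. \<nu> l * (1 / (\<theta> l + s)) * d l)"
    if s: "a + s \<noteq> 0" "\<And>l. l < k \<Longrightarrow> \<theta> l + s \<noteq> 0" for s
  proof -
    have "g l * (c * d l) / (a + s) - g l * (c * d l) / (\<theta> l + s) =
        - \<omega> * c / (a + s) * (\<nu> l * (1 / (\<theta> l + s)) * d l)" if l: "l < k" for l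
    proof -
      have "g l * (c * d l) / (a + s) - g l * (c * d l) / (\<theta> l + s) =
          c * d l * (g l * \<theta> l - a * g l) / ((a + s) * (\<theta> l + s))"
        using s(1) s(2)[OF l] by (simp add: divide_simps) (simp add: algebra_simps)
      also have "g l * \<theta> l - a * g l = - \<omega> * \<nu> l" using rel[OF l] by simp
      finally show ?thesis by (simp add: mult_ac)
    qed
    thus ?thesis
      unfolding sum_divide_distrib sum_subtractf[symmetric] sum_distrib_left by (intro sum.cong) auto
  qed
  have P0: "(\<Prod>l<k. \<theta> l) \<noteq> 0" and Pt: "(\<Prod>l<k. \<theta> l + t) \<noteq> 0" using nz by auto
  have S0: "(\<Sum>l<k. \<nu> l * (1 / \<theta> l) * d l) = K / (\<Prod>l<k. \<theta> l)"
    and St: "(\<Sum>l<k. \<nu> l * (1 / (\<theta> l + t)) * d l) = K / (\<Prod>l<k. \<theta> l + t)"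
    using K0 Kt P0 Pt by (auto simp: field_simps)
  have "(\<Sum>l<k. g l * (c * d l)) / a - (\<Sum>l<k. g l * (c * d l) / \<theta> l) = - \<omega> * c / a * (K / (\<Prod>l<k. \<theta> l))"
    using err[of 0] nz S0 by simp
  moreover have "(\<Sum>l<k. g l * (c * d l)) / (a + t) - (\<Sum>l<k. g l * (c * d l) / (\<theta> l + t)) =
      - \<omega> * c / (a + t) * (K / (\<Prod>l<k. \<theta> l + t))"
    using err[of t] nz unfolding St by simp
  ultimately show ?thesis using P0 Pt nz(1,2) by (simp add: prod_dividef)
qed

section \<open>The given eigenvalues and the trace inequality\<close>

lemma ordered_eigenvalues_diagonalisation:
  assumes M: "hermitian_pos_def n M" and lam: "ordered_eigenvalues n M lam"
  obtains U where "unitary_mat n U" "M = U * mat_diag n (\<lambda>i. complex_of_real (lam (Suc i))) * mat_adjoint U"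
    "\<And>i. i < n \<Longrightarrow> lam (Suc i) > 0"
proof -
  define es where "es = map (\<lambda>i. complex_of_real (lam (Suc i))) [0..<n]"
  have Mc: "M \<in> carrier_mat n n" and Mh: "mat_adjoint M = M" using M by (auto simp: hermitian_pos_def_def)
  have "char_poly M = (\<Prod>i<n. [:- complex_of_real (lam (Suc i)), 1:])"
    using lam by (simp add: ordered_eigenvalues_def prod.atLeast1_atMost_eq)
  also have "\<dots> = (\<Prod>e\<leftarrow>es. [:- e, 1:])"
    unfolding es_def map_map comp_def by (rule prod_list_map_upt[symmetric])
  finally obtain U where U: "unitary_mat n U" "M = U * mat_diag n ((!) es) * mat_adjoint U"
    using hermitian_diagonalisation[OF Mc Mh] by blast
  have "mat_diag n ((!) es) = mat_diag n (\<lambda>i. complex_of_real (lam (Suc i)))"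
    by (rule eq_matI) (auto simp: mat_diag_def es_def)
  hence MU: "M = U * mat_diag n (\<lambda>i. complex_of_real (lam (Suc i))) * mat_adjoint U" using U(2) by simp
  show thesis
    by (rule that[OF U(1) MU]) (use hermitian_pos_def_eigenvalues(1)[OF M MU U(1)] in simp)
qed

text \<open>\<open>lambda_max\<close> is a \<open>Max\<close> over a set of reals; the factored
  characteristic polynomial identifies this set with the finite image of {1..n} under
  \<open>lam\<close>, which contains \<open>lam 1\<close>.\<close>

lemma lambda_bar_le_lambda_max:
  assumes M: "M \<in> carrier_mat n n" and lam: "ordered_eigenvalues n M lam" and k: "1 \<le> k" "k \<le> n"
  shows "lambda_bar lam k \<le> lambda_max M"
proof -
  have mono: "lam i \<le> lam 1" if "i \<in> {1..n}" for i
    using lam that k by (auto simp: ordered_eigenvalues_def monotone_on_def)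
  have ev: "eigenvalue M (complex_of_real x) \<longleftrightarrow> x \<in> lam ` {1..n}" for x
  proof -
    have "eigenvalue M (complex_of_real x) \<longleftrightarrow> poly (\<Prod>i = 1..n. [:- complex_of_real (lam i), 1:]) (complex_of_real x) = 0"
      using lam unfolding eigenvalue_root_char_poly[OF M] by (simp add: ordered_eigenvalues_def)
    also have "\<dots> \<longleftrightarrow> (\<exists>i\<in>{1..n}. complex_of_real x - complex_of_real (lam i) = 0)"
      by (simp add: poly_prod)
    also have "\<dots> \<longleftrightarrow> x \<in> lam ` {1..n}"
      unfolding of_real_diff[symmetric] of_real_eq_0_iff by auto
    finally show ?thesis .
  qed
  have "(\<Sum>i = 1..k. lam i) \<le> (\<Sum>i = 1..k. lam 1)"
    by (rule sum_mono) (use mono k in auto)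
  hence "lambda_bar lam k \<le> 1 / (real k + 1) * (real k * lam 1 + lam 1)"
    unfolding lambda_bar_def by (intro mult_left_mono) auto
  also have "\<dots> = 1 / (real k + 1) * ((real k + 1) * lam 1)"
    by (simp add: distrib_right)
  also have "\<dots> = lam 1" by simp
  also have "\<dots> \<le> lambda_max M"
    unfolding lambda_max_def ev Collect_mem_eq using k by (intro Max_ge) auto
  finally show ?thesis .
qed

text \<open>Ky Fan's inequality. Summing the Rayleigh quotients puts on \<mu> i the squared norm of
  row i of G = U^* Q V as weight. The columns of G are unit vectors, so the weights add up to k, and
  Bessel bounds each by 1. That k is at most n falls out of the same weights.\<close>

lemma sum_ritz_values_le:
  fixes \<mu> \<theta> :: "nat \<Rightarrow> real"
  assumes U: "unitary_mat n U" and M: "M = U * mat_diag n (\<lambda>i. complex_of_real (\<mu> i)) * mat_adjoint U"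
    and V: "unitary_mat k V" and H: "mat_adjoint Q * M * Q = V * mat_diag k (\<lambda>l. complex_of_real (\<theta> l)) * mat_adjoint V"
    and Q: "Q \<in> carrier_mat n k" and QQ: "mat_adjoint Q * Q = 1\<^sub>m k" and k: "1 \<le> k"
    and mono: "\<And>i j. i \<le> j \<Longrightarrow> j < n \<Longrightarrow> \<mu> j \<le> \<mu> i"
  shows "k \<le> n" "(\<Sum>l<k. \<theta> l) \<le> (\<Sum>i<k. \<mu> i)"
proof -
  note Uc = unitary_matD[OF U] and Vc = unitary_matD[OF V]
  have Ua: "mat_adjoint U \<in> carrier_mat n n" "mat_adjoint (mat_adjoint U) * mat_adjoint U = 1\<^sub>m n"
    using Uc by simp_all
  define G where "G = mat_adjoint U * Q * V"
  note UQ = isometry_mult[OF Ua Q QQ]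
  have G: "G \<in> carrier_mat n k" "mat_adjoint G * G = 1\<^sub>m k"
    unfolding G_def using isometry_mult[OF UQ Vc(1,2)] by auto
  define p where "p = (\<lambda>i. \<Sum>l<k. (cmod (G $$ (i, l)))\<^sup>2)"
  have col: "(\<Sum>i<n. (cmod (G $$ (i, l)))\<^sup>2) = 1" if l: "l < k" for l
  proof -
    have "(mat_adjoint G * G) $$ (l, l) = (\<Sum>i<n. cnj (G $$ (i, l)) * G $$ (i, l))"
      using G(1) l by (subst mat_mult_index_sum) auto
    also have "\<dots> = complex_of_real (\<Sum>i<n. (cmod (G $$ (i, l)))\<^sup>2)"
      unfolding of_real_sum complex_norm_square by (simp add: mult.commute)
    finally have "complex_of_real (\<Sum>i<n. (cmod (G $$ (i, l)))\<^sup>2) = complex_of_real 1"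
      using G(2) l by simp
    thus ?thesis unfolding of_real_eq_iff .
  qed
  have "(\<Sum>i<n. p i) = (\<Sum>l<k. \<Sum>i<n. (cmod (G $$ (i, l)))\<^sup>2)"
    unfolding p_def by (rule sum.swap)
  also have "\<dots> = real k" using col by simp
  finally have sum: "(\<Sum>i<n. p i) = real k" .
  have p: "0 \<le> p i" "i < n \<Longrightarrow> p i \<le> 1" for i
    unfolding p_def using bessel_rows[OF G] by (auto intro: sum_nonneg)
  note top = weighted_sum_le_top_sum[of n \<mu> p k, OF mono p sum k]
  show "k \<le> n" using top(1) by simp
  have th: "\<theta> l = (\<Sum>i<n. \<mu> i * (cmod (G $$ (i, l)))\<^sup>2)" if l: "l < k" for l
  proof -
    have "complex_of_real (\<theta> l) = complex_of_real (\<Sum>i<n. \<mu> i * (cmod (G $$ (i, l)))\<^sup>2)"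
      using ritz_value_eq_weighted_sum[OF U M V H Q l] by (simp add: G_def)
    thus ?thesis unfolding of_real_eq_iff .
  qed
  have "(\<Sum>l<k. \<theta> l) = (\<Sum>l<k. \<Sum>i<n. \<mu> i * (cmod (G $$ (i, l)))\<^sup>2)"
    by (intro sum.cong th) auto
  also have "\<dots> = (\<Sum>i<n. \<mu> i * p i)"
    unfolding p_def sum_distrib_left by (rule sum.swap)
  finally show "(\<Sum>l<k. \<theta> l) \<le> (\<Sum>i<k. \<mu> i)" using top(2) by simp
qed

theorem theorem3p10:
  fixes n k :: nat and M :: "complex mat" and b :: "complex vec" and lam :: "nat \<Rightarrow> real"
  assumes "hermitian_pos_def n M"
    and "ordered_eigenvalues n M lam"
    and "b \<in> carrier_vec n" and "b \<noteq> 0\<^sub>v n"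
    and "k \<ge> 1" and "arnoldi_reaches M b k"
  shows "vec_norm (mat_sqrt M *\<^sub>v b - arnoldi_sqrt k M b)
      \<le> 1 / (2 * sqrt pi) * (2 * real k / (2 * real k - 1))
          * lambda_bar lam k powr (3 / 2) * real k powr (- 3 / 2) * vec_norm (fom_error k M b)
    \<and> lambda_bar lam k \<le> lambda_max M"
proof -
  note Mpd = assms(1) and b = assms(3) and k = assms(5)
  have Mc: "M \<in> carrier_mat n n" using Mpd by (simp add: hermitian_pos_def_def)
  \<comment> \<open>From here on the eigenvalues count from 0: \<open>\<mu> 0\<close> is
    \<open>lam 1\<close>, the largest one.\<close>
  define \<mu> where "\<mu> = (\<lambda>i. lam (Suc i))"
  obtain U where U: "unitary_mat n U"
    and M: "M = U * mat_diag n (\<lambda>i. complex_of_real (\<mu> i)) * mat_adjoint U"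
    and \<mu>: "\<And>i. i < n \<Longrightarrow> \<mu> i > 0"
    using ordered_eigenvalues_diagonalisation[OF assms(1,2)] unfolding \<mu>_def by metis
  have mono: "\<mu> j \<le> \<mu> i" if "i \<le> j" "j < n" for i j
    using assms(2) that by (auto simp: \<mu>_def ordered_eigenvalues_def monotone_on_def)
  define Q where "Q = arnoldi_Q M b k"
  define H where "H = arnoldi_H M b k"
  obtain w where Q: "Q \<in> carrier_mat n k" and Hc: "H \<in> carrier_mat k k" and QQ: "mat_adjoint Q * Q = 1\<^sub>m k"
    and w: "w \<in> carrier_vec n" and Qw: "mat_adjoint Q *\<^sub>v w = 0\<^sub>v k"
    and rel: "M * Q = Q * H + mat n k (\<lambda>(r, j). if j = k - 1 then w $ r else 0)"
    and hess: "\<And>i j. i < k \<Longrightarrow> j < k \<Longrightarrow> Suc j < i \<Longrightarrow> H $$ (i, j) = 0"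
    and bQ: "b = complex_of_real (vec_norm b) \<cdot>\<^sub>v col Q 0"
    using arnoldi_relation[OF Mc assms(3-6)] unfolding Q_def H_def by metis
  have QMQ: "mat_adjoint Q * M * Q = H" by (rule compression_eq[OF Mc Q Hc QQ w Qw rel])
  have "hermitian_pos_def k H"
    using hermitian_pos_def_compression[OF Mpd Q QQ] unfolding QMQ .
  then obtain V \<theta> where V: "unitary_mat k V" and \<theta>: "\<And>l. l < k \<Longrightarrow> \<theta> l > 0"
    and H: "H = V * mat_diag k (\<lambda>l. complex_of_real (\<theta> l)) * mat_adjoint V"
    by (rule hermitian_pos_def_diagonalisation) blast
  note Uc = unitary_matD[OF U] and Vc = unitary_matD[OF V]
  have Ua: "mat_adjoint U \<in> carrier_mat n n" using Uc(1) by simp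
  have Qa: "mat_adjoint Q \<in> carrier_mat k n" using Q by simp
  have top: "k \<le> n" "(\<Sum>l<k. \<theta> l) \<le> (\<Sum>i<k. \<mu> i)"
    using sum_ritz_values_le[OF U M V QMQ[unfolded H] Q QQ k mono] by auto
  define L where "L = lambda_bar lam k"
  have L_eq: "(real k + 1) * L = (\<Sum>i<k. \<mu> i) + \<mu> 0"
    by (simp add: L_def lambda_bar_def \<mu>_def sum.atLeast1_atMost_eq)
  have "(real k + 1) * L > 0"
    unfolding L_eq using top(1) k \<mu> by (intro add_nonneg_pos sum_nonneg less_imp_le) auto
  hence L: "L > 0" by (simp add: zero_less_mult_iff)
  \<comment> \<open>The k Ritz values are bounded by the trace inequality; the extra
    \<open>\<mu> 0\<close> pays for the factor coming from M. Together they are k + 1 numbers of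
    average at most \<open>L\<close>.\<close>
  have mean: "(\<Sum>l<k. \<theta> l) + \<mu> 0 \<le> (real k + 1) * L" using top(2) unfolding L_eq by simp

  define c where "c = complex_of_real (vec_norm b)"
  define \<beta> where "\<beta> = mat_adjoint U *\<^sub>v b"
  define G where "G = mat_adjoint U * Q * V"
  \<comment> \<open>The factor next to \<open>G\<close> is coordinate l of ||b|| e_1 in the
    eigenbasis of H.\<close>
  define g where "g = (\<lambda>i l. G $$ (i, l) * (c * cnj (V $$ (0, l))))"
  have \<beta>_eq: "\<beta> $ i = (\<Sum>l<k. g i l)" if "i < n" for i
    using first_column_coordinates[OF U V Q that k, of c] bQ by (simp add: \<beta>_def g_def G_def c_def)
  have ce: "c \<cdot>\<^sub>v unit_vec k 0 \<in> carrier_vec k" by simp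
  have Qb: "mat_adjoint Q *\<^sub>v b = c \<cdot>\<^sub>v unit_vec k 0"
  proof -
    have c0: "col Q 0 \<in> carrier_vec n" using Q k by auto
    have "mat_adjoint Q *\<^sub>v b = c \<cdot>\<^sub>v (mat_adjoint Q *\<^sub>v col Q 0)"
      by (subst bQ) (simp only: mult_mat_vec[OF Qa c0] c_def)
    also have "mat_adjoint Q *\<^sub>v col Q 0 = col (mat_adjoint Q * Q) 0"
      using k by (intro col_mult2[OF Qa Q, symmetric]) simp
    finally show ?thesis using QQ k by simp
  qed
  \<comment> \<open>One formula serves both vectors: p and q will be the square roots of the
    eigenvalues for the approximation error, and their reciprocals for the FOM error.\<close>
  have coord: "(mat_adjoint U *\<^sub>v ((U * mat_diag n (\<lambda>i. complex_of_real (p i)) * mat_adjoint U) *\<^sub>v b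
      - Q *\<^sub>v ((V * mat_diag k (\<lambda>l. complex_of_real (q l)) * mat_adjoint V) *\<^sub>v (c \<cdot>\<^sub>v unit_vec k 0)))) $ i
      = of_real (p i) * \<beta> $ i - (\<Sum>l<k. of_real (q l) * g i l)"
    if i: "i < n" for p q i
  proof -
    let ?X = "U * mat_diag n (\<lambda>i. complex_of_real (p i)) * mat_adjoint U"
    let ?Y = "V * mat_diag k (\<lambda>l. complex_of_real (q l)) * mat_adjoint V"
    have X: "?X *\<^sub>v b \<in> carrier_vec n" using Uc(1) b by (intro mult_mat_vec_carrier[of _ n n]) auto
    have Y: "Q *\<^sub>v (?Y *\<^sub>v (c \<cdot>\<^sub>v unit_vec k 0)) \<in> carrier_vec n"
      using Vc(1) Q by (intro mult_mat_vec_carrier[of _ n k] mult_mat_vec_carrier[of _ k k]) auto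
    show ?thesis
      unfolding mult_minus_distrib_mat_vec[OF Ua X Y]
      using diag_conj_coordinates[OF U b i, of "\<lambda>i. complex_of_real (p i)"]
        projected_coordinates[OF U V Q i k, of "\<lambda>l. complex_of_real (q l)" c] i Uc(1)
      by (simp add: \<beta>_def g_def G_def mult_ac del: index_mult_mat_vec)
  qed
  define d where "d = mat_sqrt M *\<^sub>v b - arnoldi_sqrt k M b"
  define \<xi> where "\<xi> = fom_error k M b"
  have sqrt_M: "mat_sqrt M = U * mat_diag n (\<lambda>i. complex_of_real (sqrt (\<mu> i))) * mat_adjoint U"
    unfolding M by (rule mat_sqrt_diag_conj[OF U \<mu>])
  have sqrt_H: "mat_sqrt H = V * mat_diag k (\<lambda>l. complex_of_real (sqrt (\<theta> l))) * mat_adjoint V"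
    unfolding H by (rule mat_sqrt_diag_conj[OF V \<theta>])
  have inv_M: "mat_inv M = U * mat_diag n (\<lambda>i. complex_of_real (1 / \<mu> i)) * mat_adjoint U"
    unfolding M by (rule mat_inv_diag_conj[OF U]) (use \<mu> in force)
  have inv_H: "mat_inv H = V * mat_diag k (\<lambda>l. complex_of_real (1 / \<theta> l)) * mat_adjoint V"
    unfolding H by (rule mat_inv_diag_conj[OF V]) (use \<theta> in force)
  have d_coord: "(mat_adjoint U *\<^sub>v d) $ i = of_real (sqrt (\<mu> i)) * \<beta> $ i - (\<Sum>l<k. of_real (sqrt (\<theta> l)) * g i l)"
    if "i < n" for i
    unfolding d_def arnoldi_sqrt_def Q_def[symmetric] H_def[symmetric] Qb sqrt_M sqrt_H by (rule coord[OF that])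
  have \<xi>_coord: "(mat_adjoint U *\<^sub>v \<xi>) $ i = of_real (1 / \<mu> i) * \<beta> $ i - (\<Sum>l<k. of_real (1 / \<theta> l) * g i l)"
    if "i < n" for i
    unfolding \<xi>_def fom_error_def Q_def[symmetric] H_def[symmetric] c_def[symmetric] inv_M inv_H
    by (rule coord[OF that])
  have d: "d \<in> carrier_vec n" and \<xi>: "\<xi> \<in> carrier_vec n"
    using Q by (auto simp: d_def \<xi>_def arnoldi_sqrt_def fom_error_def Q_def[symmetric] intro!: carrier_vecI)

  define K where "K = 1 / (2 * sqrt pi) * (2 * real k / (2 * real k - 1)) * L powr (3/2) * real k powr (- 3/2)"
  have K: "K \<ge> 0" using k by (simp add: K_def)
  have bound: "cmod ((mat_adjoint U *\<^sub>v d) $ i) \<le> K * cmod ((mat_adjoint U *\<^sub>v \<xi>) $ i)" if i: "i < n" for i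
    unfolding d_coord[OF i] K_def
  \<comment> \<open>\<open>mono[of 0 i]\<close> compares with the largest eigenvalue, which makes
    \<open>K\<close> the same for all i.\<close>
  proof (rule sqrt_combination_bound[OF \<mu>[OF i] mono[of 0 i] L k \<theta> mean \<beta>_eq[OF i]])
    fix t :: real assume t: "t > 0"
    define \<nu> where "\<nu> = (\<lambda>l. V $$ (k - 1, l))"
    \<comment> \<open>The right-hand side does not contain s; the instances at 0 and at t supply the
      constant shared by the two hypotheses of \<open>shifted_combination\<close>.\<close>
    have corner: "(\<Sum>l<k. \<nu> l * (1 / (of_real (\<theta> l) + of_real s)) * cnj (V $$ (0, l))) * (\<Prod>l<k. of_real (\<theta> l) + of_real s) =
        (- 1) ^ (k - 1) * (\<Prod>i<k - 1. H $$ (Suc i, i))" if "s \<ge> 0" for s :: real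
      unfolding \<nu>_def
    proof (rule hessenberg_resolvent_corner[OF V H k hess])
      show "complex_of_real (\<theta> l) + of_real s \<noteq> 0" if "l < k" for l
        using \<theta>[OF that] \<open>s \<ge> 0\<close> unfolding of_real_add[symmetric] of_real_eq_0_iff by linarith
    qed
    have nz: "complex_of_real (\<mu> i) + of_real t \<noteq> 0" "\<And>l. l < k \<Longrightarrow> complex_of_real (\<theta> l) + of_real t \<noteq> 0"
      unfolding of_real_add[symmetric] of_real_eq_0_iff using \<mu>[OF i] \<theta> t by (simp, force)
    have "(\<Sum>l<k. g i l) / (of_real (\<mu> i) + of_real t) - (\<Sum>l<k. g i l / (of_real (\<theta> l) + of_real t)) =
        ((\<Sum>l<k. g i l) / of_real (\<mu> i) - (\<Sum>l<k. g i l / of_real (\<theta> l))) *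
        (of_real (\<mu> i) / (of_real (\<mu> i) + of_real t) * (\<Prod>l<k. of_real (\<theta> l) / (of_real (\<theta> l) + of_real t)))"
      unfolding g_def
    proof (rule shifted_combination)
      show "complex_of_real (\<mu> i) * G $$ (i, l) = G $$ (i, l) * of_real (\<theta> l) + (mat_adjoint U *\<^sub>v w) $ i * \<nu> l" if "l < k" for l
        unfolding G_def \<nu>_def by (rule lanczos_coordinates[OF U M V H Q w k rel i that])
      show "(\<Sum>l<k. \<nu> l * (1 / of_real (\<theta> l)) * cnj (V $$ (0, l))) * (\<Prod>l<k. of_real (\<theta> l)) =
        (- 1) ^ (k - 1) * (\<Prod>i<k - 1. H $$ (Suc i, i))" using corner[of 0] by simp
      show "(\<Sum>l<k. \<nu> l * (1 / (of_real (\<theta> l) + of_real t)) * cnj (V $$ (0, l))) * (\<Prod>l<k. of_real (\<theta> l) + of_real t) =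
        (- 1) ^ (k - 1) * (\<Prod>i<k - 1. H $$ (Suc i, i))" using corner[of t] t by simp
    qed (use nz \<mu>[OF i] \<theta> in force)+
    thus "\<beta> $ i / of_real (\<mu> i + t) - (\<Sum>l<k. g i l / of_real (\<theta> l + t)) =
        (mat_adjoint U *\<^sub>v \<xi>) $ i * of_real (\<mu> i / (\<mu> i + t) * (\<Prod>l<k. \<theta> l / (\<theta> l + t)))"
      unfolding \<xi>_coord[OF i] \<beta>_eq[OF i] by simp
  qed (use i in auto)
  \<comment> \<open>A bound with one constant for all coordinates passes to the norms, and the
    adjoint of U preserves them.\<close>
  have "vec_norm (mat_adjoint U *\<^sub>v d) \<le> K * vec_norm (mat_adjoint U *\<^sub>v \<xi>)"
    by (rule vec_norm_mono_scaled[OF _ K]) (use bound Uc(1) in \<open>auto simp del: index_mult_mat_vec simp: carrier_matD\<close>)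
  hence "vec_norm d \<le> K * vec_norm \<xi>"
    unfolding vec_norm_adjoint_unitary[OF U d] vec_norm_adjoint_unitary[OF U \<xi>] .
  thus ?thesis
    using lambda_bar_le_lambda_max[OF Mc assms(2) k top(1)] unfolding K_def L_def d_def \<xi>_def by simp
qed

end
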